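(* If $\alpha$ is a nonzero algebraic number and $T$ is a positive real number, then there are only finitely many $\alpha$-exceptional points in $(0,T)$.
   Context: For a nonzero algebraic number $\alpha$, $M(\alpha)$ is the logarithmic Mahler measure of its minimal polynomial $a\prod_n(z-\alpha_n)$ over $\mathbb Z$: $M(\alpha)=\log|a|+\sum_n\log^+|\alpha_n|$. For $t\in(0,\infty)$, $M_t(\alpha)=\inf(\sum_{n=1}^N M(\alpha_n)^t)^{1/t}$ and $M_\infty(\alpha)=\inf\max_n M(\alpha_n)$, the infima taken over all factorizations $\alpha=\alpha_1\cdots\alpha_N$ with $\alpha_n\in\overline{\mathbb Q}^{\times}$. Set $\mu_\alpha(t)=M_t(\alpha)$ for $t\in(0,\infty]$. Let $\mathcal X(\mathbb R)$ be the set of real sequences $\mathbf x=(x_1,x_2,\dots)$ with $x_n=0$ for all but finitely many $n$, and put $\|\mathbf x\|_t=(\sum_n|x_n|^t)^{1/t}$ for $t\in(0,\infty)$, $\|\mathbf x\|_\infty=\max_n|x_n|$. A set $I\subseteq(0,\infty]$ is $\alpha$-uniform if there is $\mathbf x\in\mathcal X(\mathbb R)$ with $\mu_\alpha(t)=\|\mathbf x\|_t$ for all $t\in I$. A point $s\in(0,\infty]$ is $\alpha$-standard if it has an $\alpha$-uniform open neighborhood, and $\alpha$-exceptional otherwise. *)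

theory Defs
  imports
    "HOL-Analysis.Analysis"
    "HOL-Computational_Algebra.Computational_Algebra"
begin

text \<open>
  For algebraic \<open>\<alpha>\<close> the description below is unique. Irreducibility is meant in \<open>\<int>[x]\<close>; since the
  polynomial has a root it is not constant, and hence it is also primitive.
\<close>

definition min_poly_int :: "complex \<Rightarrow> int poly" where
  "min_poly_int \<alpha> = (THE p. irreducible p \<and> lead_coeff p > 0 \<and> poly (map_poly of_int p) \<alpha> = 0)"

definition log_mahler :: "complex \<Rightarrow> real" where
  "log_mahler \<alpha> = ln \<bar>real_of_int (lead_coeff (min_poly_int \<alpha>))\<bar> +
     (\<Sum>\<beta>\<in>#proots (map_poly of_int (min_poly_int \<alpha>)). ln (max 1 (cmod \<beta>)))"

definition factorizations :: "complex \<Rightarrow> complex list set" where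
  "factorizations \<alpha> =
     {as. as \<noteq> [] \<and> (\<forall>a\<in>set as. algebraic a \<and> a \<noteq> 0) \<and> prod_list as = \<alpha>}"

text \<open>
  The parameter \<open>t \<in> (0,\<infinity>]\<close> has type \<^typ>\<open>ereal\<close>; values at \<open>t \<le> 0\<close> are irrelevant.
  Note that \<open>0 powr t = 0\<close>, also for \<open>0 powr (1 / t)\<close>.
\<close>

definition metric_mahler :: "complex \<Rightarrow> ereal \<Rightarrow> real" where
  "metric_mahler \<alpha> t =
     (if t = \<infinity> then INF as\<in>factorizations \<alpha>. Max (log_mahler ` set as)
      else INF as\<in>factorizations \<alpha>.
        (\<Sum>a\<leftarrow>as. log_mahler a powr real_of_ereal t) powr (1 / real_of_ereal t))"

definition finsupp_seqs :: "(nat \<Rightarrow> real) set" where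
  "finsupp_seqs = {x. finite {n. x n \<noteq> 0}}"

definition seq_norm :: "ereal \<Rightarrow> (nat \<Rightarrow> real) \<Rightarrow> real" where
  "seq_norm t x =
     (if t = \<infinity> then Max (range (\<lambda>n. \<bar>x n\<bar>))
      else (\<Sum>n | x n \<noteq> 0. \<bar>x n\<bar> powr real_of_ereal t) powr (1 / real_of_ereal t))"

definition uniform_set :: "complex \<Rightarrow> ereal set \<Rightarrow> bool" where
  "uniform_set \<alpha> I \<longleftrightarrow>
     I \<subseteq> {0<..} \<and> (\<exists>x\<in>finsupp_seqs. \<forall>t\<in>I. metric_mahler \<alpha> t = seq_norm t x)"

definition standard_point :: "complex \<Rightarrow> ereal \<Rightarrow> bool" where
  "standard_point \<alpha> s \<longleftrightarrow>
     s > 0 \<and> (\<exists>U. openin (top_of_set {0<..}) U \<and> s \<in> U \<and> uniform_set \<alpha> U)"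

definition exceptional_point :: "complex \<Rightarrow> ereal \<Rightarrow> bool" where
  "exceptional_point \<alpha> s \<longleftrightarrow> s > 0 \<and> \<not> standard_point \<alpha> s"

end

theory Submission
  imports Defs "Jordan_Normal_Form.Char_Poly" "HOL-Complex_Analysis.Complex_Analysis"
begin

text \<open>
  Let \<open>K\<close> be the normal closure of \<open>\<rat>(\<alpha>)\<close>. Every factorization \<open>\<alpha> = \<alpha>\<^sub>1 \<cdots> \<alpha>\<^sub>m\<close> can be
  replaced, without increasing the Mahler measures, by one whose factors are roots of unity or roots
  of elements of \<open>K\<close>. Indeed, work in a Galois extension \<open>L\<close> of \<open>\<rat>\<close> containing \<open>K\<close> and all \<open>\<alpha>\<^sub>n\<close>;
  the normal subgroup \<open>N = Gal(L/K)\<close> cuts the conjugates of \<open>a = \<alpha>\<^sub>n\<close> into blocks \<open>B\<^sub>1, \<dots>, B\<^sub>e\<close> of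
  equal size \<open>d\<close>, with \<open>e \<le> [K : \<rat>]\<close>. If \<open>c\<close> is the leading coefficient of the minimal polynomial
  of \<open>a\<close>, then \<open>P(z) = c \<Prod>\<^sub>j (z - \<Prod>B\<^sub>j)\<close> has integer coefficients and Mahler measure at most \<open>M(a)\<close>. The number
  \<open>\<beta>\<close> with \<open>\<beta>\<^sup>d = \<Prod>B\<^sub>1\<close> is a root of \<open>P(z\<^sup>d)\<close>, which has the same Mahler measure as \<open>P\<close>. Applying
  the norm from \<open>L\<close> to \<open>K\<close> to the factorization shows that \<open>\<alpha>\<close> is the product of the \<open>\<beta>\<close>'s up to a
  root of unity.

  The Mahler measures of integer polynomials of degree at most a fixed \<open>D\<close> form a discrete set of
  nonnegative reals. Hence for \<open>t \<in> (0,T)\<close> only finitely many lists of positive values \<open>(v\<^sub>1, \<dots>, v\<^sub>k)\<close>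
  matter, and \<open>M\<^sub>t(\<alpha>)\<^sup>t\<close> is the minimum of finitely many exponential sums \<open>\<Sum>\<^sub>i v\<^sub>i\<^sup>t\<close>. Two different
  sums of this kind are entire in \<open>t\<close> and agree only finitely often on a compact set; away from these
  points a minimal sum stays minimal locally.
\<close>

section \<open>Algebraic integers\<close>

interpretation zmod: Modules.module "\<lambda>(n::int) (z::complex). of_int n * z"
  by unfold_locales (auto simp: algebra_simps)

text \<open>The multiplier ring of the subgroup generated by \<open>V\<close>. As multiplication by
  \<open>b\<close> is additive, testing the generators suffices.\<close>

definition zstable :: "complex set \<Rightarrow> complex set" where
  "zstable V = {b. \<forall>v\<in>V. b * v \<in> zmod.span V}"

text \<open>The hypotheses make \<open>z\<close> an eigenvalue of an integer matrix, and the
  characteristic polynomial of such a matrix is monic with integer coefficients.\<close>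

lemma algebraic_int_eigenvalue:
  fixes A :: "nat \<Rightarrow> nat \<Rightarrow> int" and v :: "nat \<Rightarrow> complex"
  assumes eq: "\<And>i. i < n \<Longrightarrow> z * v i = (\<Sum>j<n. of_int (A i j) * v j)"
    and nz: "i0 < n" "v i0 \<noteq> 0"
  shows "algebraic_int z"
proof -
  define AA where "AA = Matrix.mat n n (\<lambda>(i,j). A i j)"
  define CC where "CC = Matrix.mat n n (\<lambda>(i,j). complex_of_int (A i j))"
  define w where "w = Matrix.vec n v"
  have C: "CC \<in> carrier_mat n n" and A: "AA \<in> carrier_mat n n" by (auto simp: CC_def AA_def)
  have "CC *\<^sub>v w = z \<cdot>\<^sub>v w"
    by (rule eq_vecI) (auto simp: CC_def w_def scalar_prod_def eq lessThan_atLeast0)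
  moreover have "w \<noteq> 0\<^sub>v n"
    using nz by (metis index_vec index_zero_vec(1) w_def)
  ultimately have "eigenvalue CC z"
    unfolding eigenvalue_def eigenvector_def by (intro exI[of _ w]) (auto simp: C w_def CC_def)
  hence root: "poly (char_poly CC) z = 0" using eigenvalue_root_char_poly[OF C] by simp
  have "CC = map_mat of_int AA" by (auto simp: CC_def AA_def)
  hence "char_poly CC = map_poly of_int (char_poly AA)"
    using of_int_hom.char_poly_hom[OF A] by metis
  moreover have "lead_coeff (char_poly CC) = 1" using degree_monic_char_poly[OF C] by simp
  ultimately show ?thesis
    using root by (intro algebraic_int.intros[of "char_poly CC"]) (auto simp: coeff_map_poly)
qed

text \<open>Multiplication by \<open>b\<close> acts on the finitely many generators through an
  integer matrix; the generator 1 makes the eigenvector nonzero.\<close>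

lemma zstable_imp_algebraic_int:
  assumes V: "finite V" "1 \<in> V" and b: "b \<in> zstable V"
  shows "algebraic_int b"
proof -
  obtain f where f: "bij_betw f {..<card V} V"
    using ex_bij_betw_nat_finite[OF V(1)] by (auto simp: lessThan_atLeast0)
  have "\<exists>c. b * f i = (\<Sum>j<card V. of_int (c j) * f j)" if "i < card V" for i
  proof -
    have "b * f i \<in> zmod.span V"
      using b that f by (auto simp: zstable_def bij_betw_def)
    then obtain u where "b * f i = (\<Sum>v\<in>V. of_int (u v) * v)"
      using zmod.span_finite[OF V(1)] by auto
    also have "\<dots> = (\<Sum>j<card V. of_int (u (f j)) * f j)"
      using sum.reindex_bij_betw[OF f, of "\<lambda>v. of_int (u v) * v"] by simp
    finally show ?thesis by (intro exI[of _ "\<lambda>j. u (f j)"])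
  qed
  then obtain c where c: "\<And>i. i < card V \<Longrightarrow> b * f i = (\<Sum>j<card V. of_int (c i j) * f j)"
    by metis
  obtain i0 where "i0 < card V" "f i0 = 1"
    using f V(2) by (metis bij_betw_imp_surj_on imageE lessThan_iff)
  with c show ?thesis by (intro algebraic_int_eigenvalue[of "card V" b f c i0]) auto
qed

lemma zstable_span:
  assumes "b \<in> zstable V" "x \<in> zmod.span V" shows "b * x \<in> zmod.span V"
  using assms(2)
proof (induction rule: zmod.span_induct_alt)
  case (step c v y)
  have "b * (of_int c * v + y) = of_int c * (b * v) + b * y" by (simp add: algebra_simps)
  thus ?case using step assms(1) zmod.span_add zmod.span_scale[of "b * v" V c]
    by (simp add: zstable_def)
qed (auto simp: zmod.span_zero)

lemma of_int_zstable: "of_int n \<in> zstable V"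
  by (auto simp: zstable_def intro: zmod.span_scale zmod.span_base)

lemma zstable_add: "a \<in> zstable V \<Longrightarrow> b \<in> zstable V \<Longrightarrow> a + b \<in> zstable V"
  by (auto simp: zstable_def distrib_right intro: zmod.span_add)

lemma zstable_mult: "a \<in> zstable V \<Longrightarrow> b \<in> zstable V \<Longrightarrow> a * b \<in> zstable V"
  using zstable_span[of a V] by (auto simp: zstable_def mult.assoc)

text \<open>The products \<open>z ^ i * v\<close> with \<open>i < degree p\<close> generate the
  larger module. Multiplication by \<open>z\<close> either raises the exponent or reaches
  \<open>z ^ n\<close>, which \<open>p\<close> rewrites in lower powers with coefficients that
  stabilise the span of \<open>V\<close>.\<close>

lemma zstable_adjoin:
  assumes V: "finite V" "1 \<in> V" and p: "lead_coeff p = 1" "poly p z = 0"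
    and c: "\<And>i. coeff p i \<in> zstable V"
  obtains W where "finite W" "1 \<in> W" "zstable V \<subseteq> zstable W" "z \<in> zstable W"
proof -
  define n where "n = degree p"
  have "n \<noteq> 0"
  proof
    assume "n = 0"
    then have "p = [:1:]" using p(1) by (metis n_def degree_eq_zeroE lead_coeff_pCons(2) pCons_0_0)
    thus False using p(2) by simp
  qed
  define W where "W = (\<lambda>(i,v). z ^ i * v) ` ({..<n} \<times> V)"
  have mem: "z ^ i * v \<in> W" if "i < n" "v \<in> V" for i v using that by (auto simp: W_def)
  have sp: "z ^ i * x \<in> zmod.span W" if "i < n" "x \<in> zmod.span V" for i x
    using that(2)
  proof (induction rule: zmod.span_induct_alt)
    case (step c v y)
    have "z ^ i * (of_int c * v + y) = of_int c * (z ^ i * v) + z ^ i * y"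
      by (simp add: algebra_simps)
    thus ?case using step zmod.span_add zmod.span_scale[of "z ^ i * v" W c]
        zmod.span_base[OF mem[OF that(1)]] by simp
  qed (auto simp: zmod.span_zero)
  have "zstable V \<subseteq> zstable W"
  proof
    fix b assume b: "b \<in> zstable V"
    have "b * w \<in> zmod.span W" if w: "w \<in> W" for w
    proof -
      obtain i v where "w = z ^ i * v" "i < n" "v \<in> V" using w by (auto simp: W_def)
      thus ?thesis using sp[of i "b * v"] b by (simp add: zstable_def mult.left_commute)
    qed
    thus "b \<in> zstable W" by (simp add: zstable_def)
  qed
  moreover have "z \<in> zstable W"
    unfolding zstable_def
  proof (intro CollectI ballI)
    fix w assume "w \<in> W"
    then obtain i v where w: "w = z ^ i * v" "i < n" "v \<in> V" by (auto simp: W_def)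
    show "z * w \<in> zmod.span W"
    proof (cases "Suc i < n")
      case True
      thus ?thesis using mem[OF True w(3)] w(1) by (auto intro!: zmod.span_base simp: mult.assoc)
    next
      case False
      with w have i: "Suc i = n" by simp
      have "0 = (\<Sum>j\<le>n. coeff p j * z ^ j)" using p(2) by (simp add: poly_altdef n_def)
      also have "\<dots> = z ^ n + (\<Sum>j<n. coeff p j * z ^ j)"
        using p(1) by (simp flip: lessThan_Suc_atMost add: n_def)
      finally have "z ^ n = (\<Sum>j<n. - coeff p j * z ^ j)"
        by (simp add: sum_negf eq_neg_iff_add_eq_0)
      moreover have "z * w = z ^ n * v" using w i by auto
      ultimately have "z * w = (\<Sum>j<n. - (z ^ j * (coeff p j * v)))"
        by (simp add: sum_distrib_left sum_negf mult_ac)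
      also have "\<dots> \<in> zmod.span W"
        using c w by (intro zmod.span_sum zmod.span_neg sp) (auto simp: zstable_def)
      finally show ?thesis .
    qed
  qed
  moreover have "1 \<in> W" using mem[of 0 1] V \<open>n \<noteq> 0\<close> by simp
  ultimately show ?thesis using V that[of W] by (simp add: W_def)
qed

text \<open>Starting from \<open>{1}\<close>, the numbers are adjoined one at a time. A module
  common to several algebraic integers is what makes their sums and products integral.\<close>

lemma algebraic_ints_zstable:
  assumes "finite A" "\<And>a. a \<in> A \<Longrightarrow> algebraic_int a"
  obtains V where "finite V" "1 \<in> V" "A \<subseteq> zstable V"
  using assms
proof (induction A arbitrary: thesis rule: finite_induct)
  case empty
  thus ?case by (metis empty_subsetI finite.emptyI finite_insert insertI1)
next
  case (insert a A)
  obtain V where V: "finite V" "1 \<in> V" "A \<subseteq> zstable V" using insert by blast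
  obtain p where p: "lead_coeff p = 1" "poly p a = 0" "\<And>i. coeff p i \<in> \<int>"
    using insert(5)[of a] by (auto elim!: algebraic_int.cases)
  have "coeff p i \<in> zstable V" for i
    using p(3)[of i] of_int_zstable by (auto elim!: Ints_cases)
  from zstable_adjoin[OF V(1,2) p(1,2) this] V(3) insert(4) show ?case
    by (metis insert_subset order_trans)
qed

lemma algebraic_int_add:
  assumes "algebraic_int a" "algebraic_int b" shows "algebraic_int (a + b :: complex)"
proof -
  obtain V where "finite V" "1 \<in> V" "{a, b} \<subseteq> zstable V"
    using algebraic_ints_zstable[of "{a,b}"] assms by blast
  thus ?thesis by (intro zstable_imp_algebraic_int[of V] zstable_add) auto
qed

lemma algebraic_int_mult:
  assumes "algebraic_int a" "algebraic_int b" shows "algebraic_int (a * b :: complex)"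
proof -
  obtain V where "finite V" "1 \<in> V" "{a, b} \<subseteq> zstable V"
    using algebraic_ints_zstable[of "{a,b}"] assms by blast
  thus ?thesis by (intro zstable_imp_algebraic_int[of V] zstable_mult) auto
qed

lemma algebraic_int_diff:
  assumes "algebraic_int a" "algebraic_int b" shows "algebraic_int (a - b :: complex)"
  using algebraic_int_add[OF assms(1), of "-b"] assms(2) by simp

lemma algebraic_int_power: "algebraic_int a \<Longrightarrow> algebraic_int (a ^ n :: complex)"
  by (induction n) (auto intro: algebraic_int_mult)

text \<open>The coefficients stabilise a common finitely generated module, to which the root
  \<open>z\<close> can then be adjoined.\<close>

lemma algebraic_int_integrally_closed:
  assumes "lead_coeff p = 1" "poly p z = 0" "\<And>i. algebraic_int (coeff p i)"
  shows "algebraic_int (z :: complex)"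
proof -
  obtain V where V: "finite V" "1 \<in> V" "set (coeffs p) \<subseteq> zstable V"
    using algebraic_ints_zstable[of "set (coeffs p)"] assms(3)
    by (metis List.finite_set in_set_conv_nth coeffs_nth length_coeffs_degree coeffs_eq_Nil
        less_Suc_eq_le list.size(3) not_less_zero)
  have "coeff p i \<in> zstable V" for i
    using V(3) of_int_zstable[of 0 V]
      by (metis coeff_in_coeffs coeff_0 coeff_eq_0 not_le of_int_0 subsetD)
  from zstable_adjoin[OF V(1,2) assms(1,2) this] zstable_imp_algebraic_int show ?thesis by metis
qed

section \<open>Polynomials whose coefficients are algebraic integers\<close>

definition polys_over :: "complex set \<Rightarrow> complex poly set" where
  "polys_over F = {p. \<forall>i. coeff p i \<in> F}"

text \<open>With \<open>b\<close> the leading coefficient and \<open>n\<close> the degree,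
  \<open>b ^ (n - 1) * poly p z\<close> is a monic polynomial in \<open>b * z\<close> with integral
  coefficients.\<close>

lemma lead_coeff_mult_root_algebraic_int:
  fixes p :: "complex poly"
  assumes p: "p \<in> polys_over (Collect algebraic_int)" and z: "poly p z = 0" and deg: "degree p > 0"
  shows "algebraic_int (lead_coeff p * z)"
proof -
  define n b where "n = degree p" and "b = lead_coeff p"
  define q where "q = monom 1 n + (\<Sum>i<n. monom (coeff p i * b ^ (n - Suc i)) i)"
  have cq: "coeff q i = (if i = n then 1 else if i < n then coeff p i * b ^ (n - Suc i) else 0)" for i
    by (auto simp: q_def coeff_sum)
  have degq: "degree q = n"
    by (rule antisym) (auto intro!: degree_le le_degree simp: cq)
  have alg: "algebraic_int (coeff p i)" for i using p by (auto simp: polys_over_def)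
  have "poly q (b * z) = (\<Sum>i\<le>n. coeff q i * (b * z) ^ i)"
    by (simp add: poly_altdef degq)
  also have "\<dots> = (\<Sum>i\<le>n. b ^ (n - 1) * (coeff p i * z ^ i))"
  proof (rule sum.cong[OF refl])
    fix i assume "i \<in> {..n}"
    consider "i = n" | "i < n" using \<open>i \<in> {..n}\<close> by force
    thus "coeff q i * (b * z) ^ i = b ^ (n - 1) * (coeff p i * z ^ i)"
    proof cases
      case 1
      have "b ^ n = b ^ (n - 1) * b" using deg by (cases n) (auto simp: n_def)
      thus ?thesis using 1 by (simp add: cq power_mult_distrib b_def n_def)
    next
      case 2
      have "b ^ (n - 1) = b ^ (n - Suc i) * b ^ i" using 2 by (simp flip: power_add)
      thus ?thesis using 2 by (simp add: cq power_mult_distrib)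
    qed
  qed
  also have "\<dots> = b ^ (n - 1) * poly p z" by (simp add: poly_altdef n_def sum_distrib_left)
  finally have "poly q (b * z) = 0" using z by simp
  moreover have "algebraic_int (coeff q i)" for i
    using alg by (auto simp: cq b_def intro!: algebraic_int_mult algebraic_int_power)
  ultimately show ?thesis
    using algebraic_int_integrally_closed[of q "b * z"] degq by (simp add: cq b_def)
qed

text \<open>By induction on the degree. The leading coefficient \<open>b\<close> of \<open>v\<close>
  is also that of the product, and \<open>b * c\<close> is integral because \<open>c\<close> is a
  root of the product. So the leading term of \<open>v\<close> can be stripped off, and the rest
  still has an integral product with the linear factor.\<close>

lemma linear_factor_quotient_algebraic_int:
  fixes v :: "complex poly"
  assumes "v * [:-c, 1:] \<in> polys_over (Collect algebraic_int)"
  shows "v \<in> polys_over (Collect algebraic_int)"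
  using assms
proof (induction "degree v" arbitrary: v rule: less_induct)
  case less
  show ?case
  proof (cases "v = 0")
    case False
    define b n where "b = lead_coeff v" and "n = degree v"
    have deg: "degree (v * [:-c, 1:]) = Suc n"
      using False by (simp add: degree_mult_eq n_def del: mult_pCons_right)
    have lc: "lead_coeff (v * [:-c, 1:]) = b"
      by (simp add: lead_coeff_mult b_def del: mult_pCons_right)
    have bc: "algebraic_int (b * c)"
      using lead_coeff_mult_root_algebraic_int[OF less(2), of c] deg lc
        by (simp del: mult_pCons_right)
    have b: "algebraic_int b" using less(2) lc by (metis mem_Collect_eq polys_over_def)
    define w where "w = v - monom b n"
    have *: "w * [:-c, 1:] = v * [:-c, 1:] - (monom b (Suc n) - monom (b * c) n)"
      by (simp add: w_def algebra_simps smult_monom monom_Suc smult_diff_right add_monom)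
    have mon: "algebraic_int (coeff (monom x k) i)" if "algebraic_int x" for x :: complex and k i
      using that by simp
    have "w * [:-c, 1:] \<in> polys_over (Collect algebraic_int)"
      using less(2) mon[OF b] mon[OF bc] unfolding * polys_over_def
      by (auto intro!: algebraic_int_diff simp del: mult_pCons_right coeff_monom)
    moreover have "w = 0 \<or> degree w < degree v"
    proof (cases "n = 0")
      case True
      then show ?thesis by (auto simp: w_def b_def n_def monom_0 elim!: degree_eq_zeroE)
    next
      case n: False
      have "degree w \<le> n" by (auto simp: w_def n_def intro: degree_diff_le degree_monom_le)
      moreover have "coeff w n = 0" by (simp add: w_def b_def n_def)
      ultimately show ?thesis using n
        by (metis leading_coeff_0_iff n_def order_le_less)
    qed
    ultimately have "w \<in> polys_over (Collect algebraic_int)"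
      using less(1)[of w] by (auto simp: polys_over_def)
    moreover have "v = w + monom b n" by (simp add: w_def)
    ultimately show ?thesis using mon[OF b, of n]
      by (auto simp: polys_over_def simp del: coeff_monom intro!: algebraic_int_add)
  qed (auto simp: polys_over_def)
qed

lemma contract_linear_factors_algebraic_int:
  fixes u :: "complex poly"
  assumes "finite B" "u * (\<Prod>c\<in>B. [:-c, 1:]) \<in> polys_over (Collect algebraic_int)"
  shows "u * [:- \<Prod>B, 1:] \<in> polys_over (Collect algebraic_int)"
proof -
  \<comment> \<open>If \<open>v (z - c)\<close> has integral coefficients, then so does \<open>v\<close>, and hence also \<open>c v = z v - v (z - c)\<close>.\<close>
  have "u \<in> polys_over (Collect algebraic_int) \<and> Polynomial.smult (\<Prod>B) u \<in> polys_over (Collect algebraic_int)"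
    using assms
  proof (induction B arbitrary: u rule: finite_induct)
    case (insert c B)
    have "(u * [:-c, 1:]) * (\<Prod>c\<in>B. [:-c, 1:]) \<in> polys_over (Collect algebraic_int)"
      using insert by (simp add: mult.assoc del: mult_pCons_right mult_pCons_left)
    from insert.IH[OF this] 
    have 1: "u * [:-c, 1:] \<in> polys_over (Collect algebraic_int)"
      and 2: "Polynomial.smult (\<Prod>B) u * [:-c, 1:] \<in> polys_over (Collect algebraic_int)"
      by (simp_all del: mult_pCons_right)
    have 3: "u \<in> polys_over (Collect algebraic_int)" "Polynomial.smult (\<Prod>B) u \<in> polys_over (Collect algebraic_int)"
      using linear_factor_quotient_algebraic_int 1 2 by blast+
    have "coeff (Polynomial.smult (\<Prod>(insert c B)) u) i =
          coeff (pCons 0 (Polynomial.smult (\<Prod>B) u)) i - coeff (Polynomial.smult (\<Prod>B) u * [:-c, 1:]) i" for i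
      using insert(1,2) by (cases i) (simp_all add: algebra_simps)
    moreover have "pCons 0 (Polynomial.smult (\<Prod>B) u) \<in> polys_over (Collect algebraic_int)"
      using 3 by (auto simp: polys_over_def coeff_pCons split: nat.splits)
    ultimately have "Polynomial.smult (\<Prod>(insert c B)) u \<in> polys_over (Collect algebraic_int)"
      using 2 unfolding polys_over_def
        by (auto intro: algebraic_int_diff simp del: mult_pCons_right)
    with 3 show ?case by blast
  qed (auto simp: polys_over_def)
  moreover have "coeff (u * [:- \<Prod>B, 1:]) i = coeff (pCons 0 u) i - coeff (Polynomial.smult (\<Prod>B) u) i" for i
    by simp
  ultimately show ?thesis
    unfolding polys_over_def 
    by (auto simp: coeff_pCons split: nat.splits intro!: algebraic_int_diff simp del: mult_pCons_right)
qed

section \<open>Homomorphisms between subfields of the complex numbers\<close>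

text \<open>Closure under differences also supplies 0 and negatives; inverses need no exception at
  0, since \<open>inverse 0 = 0\<close>.\<close>

definition subfield_C :: "complex set \<Rightarrow> bool" where
  "subfield_C F \<longleftrightarrow> 1 \<in> F \<and> (\<forall>x\<in>F. \<forall>y\<in>F. x - y \<in> F \<and> x * y \<in> F) \<and> (\<forall>x\<in>F. inverse x \<in> F)"

text \<open>For a subfield \<open>F\<close> this is an embedding of \<open>F\<close> into the
  complex numbers; being unital, it is injective on \<open>F\<close>.\<close>

definition hom_on :: "complex set \<Rightarrow> (complex \<Rightarrow> complex) \<Rightarrow> bool" where
  "hom_on F \<sigma> \<longleftrightarrow> \<sigma> 1 = 1 \<and>
     (\<forall>x\<in>F. \<forall>y\<in>F. \<sigma> (x + y) = \<sigma> x + \<sigma> y \<and> \<sigma> (x * y) = \<sigma> x * \<sigma> y)"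

context
  fixes F :: "complex set" assumes F: "subfield_C F"
begin

lemma subfield_one: "1 \<in> F" and subfield_diff: "x \<in> F \<Longrightarrow> y \<in> F \<Longrightarrow> x - y \<in> F"
  and subfield_mult: "x \<in> F \<Longrightarrow> y \<in> F \<Longrightarrow> x * y \<in> F"
  and subfield_inverse: "x \<in> F \<Longrightarrow> inverse x \<in> F"
  using F by (auto simp: subfield_C_def)

lemma subfield_zero: "0 \<in> F"
  using subfield_diff[OF subfield_one subfield_one] by simp

lemma subfield_uminus: "x \<in> F \<Longrightarrow> - x \<in> F"
  using subfield_diff[OF subfield_zero] by simp

lemma subfield_add: "x \<in> F \<Longrightarrow> y \<in> F \<Longrightarrow> x + y \<in> F"
  using subfield_diff[OF _ subfield_uminus] by fastforce

lemma subfield_divide: "x \<in> F \<Longrightarrow> y \<in> F \<Longrightarrow> x / y \<in> F"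
  by (simp add: divide_inverse subfield_mult subfield_inverse)

lemma subfield_sum: "(\<And>i. i \<in> A \<Longrightarrow> f i \<in> F) \<Longrightarrow> sum f A \<in> F"
  by (induction A rule: infinite_finite_induct) (auto simp: subfield_zero subfield_add)

lemma subfield_prod: "(\<And>i. i \<in> A \<Longrightarrow> f i \<in> F) \<Longrightarrow> prod f A \<in> F"
  by (induction A rule: infinite_finite_induct) (auto simp: subfield_one subfield_mult)

lemma subfield_prod_list: "set xs \<subseteq> F \<Longrightarrow> prod_list xs \<in> F"
  by (induction xs) (auto simp: subfield_one subfield_mult)

lemma subfield_power: "x \<in> F \<Longrightarrow> x ^ n \<in> F"
  by (induction n) (auto simp: subfield_one subfield_mult)

lemma subfield_of_nat: "of_nat n \<in> F"
  by (induction n) (auto simp: subfield_zero subfield_one subfield_add)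

lemma subfield_of_int: "of_int n \<in> F"
  by (cases n rule: int_cases2) (auto simp: subfield_of_nat subfield_uminus)

lemma polys_over_diff: "p \<in> polys_over F \<Longrightarrow> q \<in> polys_over F \<Longrightarrow> p - q \<in> polys_over F"
  by (auto simp: polys_over_def subfield_diff)

lemma polys_over_add: "p \<in> polys_over F \<Longrightarrow> q \<in> polys_over F \<Longrightarrow> p + q \<in> polys_over F"
  by (auto simp: polys_over_def subfield_add)

lemma polys_over_mult: "p \<in> polys_over F \<Longrightarrow> q \<in> polys_over F \<Longrightarrow> p * q \<in> polys_over F"
  by (auto simp: polys_over_def coeff_mult intro!: subfield_sum subfield_mult)

lemma polys_over_const: "c \<in> F \<Longrightarrow> [:c:] \<in> polys_over F"
  by (auto simp: polys_over_def coeff_pCons subfield_zero split: nat.splits)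

lemma polys_over_pCons: "c \<in> F \<Longrightarrow> p \<in> polys_over F \<Longrightarrow> pCons c p \<in> polys_over F"
  by (auto simp: polys_over_def coeff_pCons split: nat.splits)

lemma polys_over_prod: "(\<And>i. i \<in> A \<Longrightarrow> f i \<in> polys_over F) \<Longrightarrow> prod f A \<in> polys_over F"
  using polys_over_const[OF subfield_one]
  by (induction A rule: infinite_finite_induct) (auto simp: polys_over_mult one_pCons)

text \<open>Long division by a polynomial whose leading coefficient is invertible in
  \<open>F\<close>, so that quotient and remainder keep their coefficients in
  \<open>F\<close>.\<close>

lemma polys_over_division:
  assumes m: "m \<in> polys_over F" "m \<noteq> 0" and p: "p \<in> polys_over F"
  obtains q r where "q \<in> polys_over F" "r \<in> polys_over F" "p = m * q + r" "r = 0 \<or> degree r < degree m"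
  using p
proof (induction "degree p" arbitrary: p thesis rule: less_induct)
  case less
  show ?case
  proof (cases "p = 0 \<or> degree p < degree m")
    case True
    thus ?thesis using less(2)[of 0 p] less(3) polys_over_const[OF subfield_zero] by auto
  next
    case False
    define t where "t = monom (lead_coeff p / lead_coeff m) (degree p - degree m)"
    define p' where "p' = p - m * t"
    have t: "t \<in> polys_over F"
      using m less(3) by (auto simp: t_def polys_over_def intro!: subfield_divide subfield_zero)
    have p': "p' \<in> polys_over F"
      unfolding p'_def by (intro polys_over_diff polys_over_mult less(3) m(1) t)
    have tnz: "lead_coeff p / lead_coeff m \<noteq> 0" using False m by simp
    have dt: "degree (m * t) = degree p"
      using False m tnz by (subst degree_mult_eq) (auto simp: t_def degree_monom_eq)
    have lc: "lead_coeff (m * t) = lead_coeff p"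
      using m(2) lead_coeff_monom[of "lead_coeff p / lead_coeff m" "degree p - degree m"]
      unfolding lead_coeff_mult t_def by simp
    have "p' = 0 \<or> degree p' < degree p"
    proof (cases "degree p = 0")
      case True
      then show ?thesis using dt lc unfolding p'_def
        by (metis degree_eq_zeroE diff_self lead_coeff_pCons(2) pCons_0_0 pCons_eq_0_iff)
    next
      case d: False
      have "coeff p' (degree p) = 0" using lc dt by (simp add: p'_def)
      moreover have "degree p' \<le> degree p"
        unfolding p'_def by (rule degree_diff_le) (use dt in auto)
      ultimately show ?thesis using d by (metis leading_coeff_0_iff order_le_less)
    qed
    then obtain q r where qr: "q \<in> polys_over F" "r \<in> polys_over F" "p' = m * q + r"
        "r = 0 \<or> degree r < degree m"
    proof
      assume "p' = 0"
      thus ?thesis using that[of 0 0] polys_over_const[OF subfield_zero] by auto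
    qed (use less(1)[OF _ _ p'] that in blast)
    have "p = m * (q + t) + r" using qr(3) by (simp add: p'_def algebra_simps)
    thus ?thesis using less(2)[of "q + t" r] qr t polys_over_add by auto
  qed
qed

end

context
  fixes F :: "complex set" and \<sigma> assumes F: "subfield_C F" and \<sigma>: "hom_on F \<sigma>"
begin

lemma hom_one: "\<sigma> 1 = 1" and hom_add: "x \<in> F \<Longrightarrow> y \<in> F \<Longrightarrow> \<sigma> (x + y) = \<sigma> x + \<sigma> y"
  and hom_mult: "x \<in> F \<Longrightarrow> y \<in> F \<Longrightarrow> \<sigma> (x * y) = \<sigma> x * \<sigma> y"
  using \<sigma> by (auto simp: hom_on_def)

lemma hom_zero: "\<sigma> 0 = 0"
  using hom_add[OF subfield_zero[OF F] subfield_zero[OF F]] by simp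

lemma hom_uminus: "x \<in> F \<Longrightarrow> \<sigma> (- x) = - \<sigma> x"
  using hom_add[of x "-x"] subfield_uminus[OF F] hom_zero by (simp add: minus_unique)

lemma hom_diff: "x \<in> F \<Longrightarrow> y \<in> F \<Longrightarrow> \<sigma> (x - y) = \<sigma> x - \<sigma> y"
  using hom_add[of x "-y"] subfield_uminus[OF F] hom_uminus by simp

lemma hom_eq_0_iff: "x \<in> F \<Longrightarrow> \<sigma> x = 0 \<longleftrightarrow> x = 0"
  using hom_mult[of x "inverse x"] subfield_inverse[OF F] hom_one hom_zero
  by (metis mult_zero_left right_inverse zero_neq_one)

lemma hom_inverse: "x \<in> F \<Longrightarrow> \<sigma> (inverse x) = inverse (\<sigma> x)"
  using hom_mult[of x "inverse x"] subfield_inverse[OF F] hom_one hom_zero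
  by (metis inverse_unique inverse_zero right_inverse)

lemma hom_inj: "inj_on \<sigma> F"
  using hom_diff hom_eq_0_iff subfield_diff[OF F] by (intro inj_onI) (metis eq_iff_diff_eq_0)

lemma hom_sum: "(\<And>i. i \<in> A \<Longrightarrow> f i \<in> F) \<Longrightarrow> \<sigma> (sum f A) = (\<Sum>i\<in>A. \<sigma> (f i))"
  by (induction A rule: infinite_finite_induct) (auto simp: hom_zero hom_add subfield_sum[OF F])

lemma hom_prod: "(\<And>i. i \<in> A \<Longrightarrow> f i \<in> F) \<Longrightarrow> \<sigma> (prod f A) = (\<Prod>i\<in>A. \<sigma> (f i))"
  by (induction A rule: infinite_finite_induct) (auto simp: hom_one hom_mult subfield_prod[OF F])

lemma hom_prod_list: "set xs \<subseteq> F \<Longrightarrow> \<sigma> (prod_list xs) = prod_list (map \<sigma> xs)"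
  by (induction xs) (auto simp: hom_one hom_mult subfield_prod_list[OF F])

lemma hom_power: "x \<in> F \<Longrightarrow> \<sigma> (x ^ n) = \<sigma> x ^ n"
  by (induction n) (auto simp: hom_one hom_mult subfield_power[OF F])

lemma hom_of_nat: "\<sigma> (of_nat n) = of_nat n"
  by (induction n) (auto simp: hom_zero hom_one hom_add subfield_one[OF F] subfield_of_nat[OF F])

lemma hom_of_int: "\<sigma> (of_int n) = of_int n"
  using hom_of_nat hom_uminus[OF subfield_of_nat[OF F]]
  by (cases n rule: int_cases2) auto

lemma hom_coeff: "coeff (map_poly \<sigma> p) i = \<sigma> (coeff p i)"
  by (simp add: coeff_map_poly hom_zero)

lemma hom_poly_add: "p \<in> polys_over F \<Longrightarrow> q \<in> polys_over F \<Longrightarrow>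
    map_poly \<sigma> (p + q) = map_poly \<sigma> p + map_poly \<sigma> q"
  by (rule poly_eqI) (auto simp: hom_coeff polys_over_def hom_add)

lemma hom_poly_diff: "p \<in> polys_over F \<Longrightarrow> q \<in> polys_over F \<Longrightarrow>
    map_poly \<sigma> (p - q) = map_poly \<sigma> p - map_poly \<sigma> q"
  by (rule poly_eqI) (auto simp: hom_coeff polys_over_def hom_diff)

lemma hom_poly_mult: "p \<in> polys_over F \<Longrightarrow> q \<in> polys_over F \<Longrightarrow>
    map_poly \<sigma> (p * q) = map_poly \<sigma> p * map_poly \<sigma> q"
  by (rule poly_eqI)
     (auto simp: hom_coeff polys_over_def coeff_mult hom_mult hom_sum subfield_mult[OF F])

lemma hom_poly_prod: "(\<And>i. i \<in> A \<Longrightarrow> f i \<in> polys_over F) \<Longrightarrow>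
    map_poly \<sigma> (prod f A) = (\<Prod>i\<in>A. map_poly \<sigma> (f i))"
  by (induction A rule: infinite_finite_induct)
     (auto simp: hom_one hom_poly_mult polys_over_prod[OF F])

lemma hom_poly_eval: "p \<in> polys_over F \<Longrightarrow> x \<in> F \<Longrightarrow> poly (map_poly \<sigma> p) (\<sigma> x) = \<sigma> (poly p x)"
proof -
  assume p: "p \<in> polys_over F" and x: "x \<in> F"
  have "degree (map_poly \<sigma> p) = degree p"
    by (rule degree_map_poly) (use p hom_eq_0_iff in \<open>auto simp: polys_over_def\<close>)
  thus ?thesis using p x
    by (simp add: poly_altdef hom_coeff polys_over_def hom_sum hom_mult hom_power
        subfield_mult[OF F] subfield_power[OF F])
qed

lemma hom_int_root:
  assumes "x \<in> F" "poly (map_poly of_int p) x = 0"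
  shows "poly (map_poly of_int p) (\<sigma> x) = 0"
proof -
  have p: "map_poly of_int p \<in> polys_over F"
    by (auto simp: polys_over_def coeff_map_poly subfield_of_int[OF F])
  have "map_poly \<sigma> (map_poly of_int p) = map_poly of_int p"
    by (rule poly_eqI) (simp add: hom_coeff coeff_map_poly hom_of_int)
  thus ?thesis using hom_poly_eval[OF p assms(1)] assms(2) hom_zero by simp
qed

end

section \<open>Extending embeddings to larger fields\<close>

lemma hom_extend_simple:
  assumes F: "subfield_C F" and \<sigma>: "hom_on F \<sigma>"
    and m: "m \<in> polys_over F" "m \<noteq> 0" "poly m r = 0"
    and min: "\<And>p. p \<in> polys_over F \<Longrightarrow> p \<noteq> 0 \<Longrightarrow> poly p r = 0 \<Longrightarrow> degree m \<le> degree p"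
    and s: "poly (map_poly \<sigma> m) s = 0"
  obtains F' \<sigma>' where "subfield_C F'" "hom_on F' \<sigma>'" "F \<subseteq> F'" "r \<in> F'" "\<sigma>' r = s"
    "\<And>x. x \<in> F \<Longrightarrow> \<sigma>' x = \<sigma> x"
proof -
  note [intro] = polys_over_add[OF F] polys_over_diff[OF F] polys_over_mult[OF F] polys_over_const[OF F]
  \<comment> \<open>This is \<open>F[r]\<close>, which is a field because \<open>m\<close> has least
    degree among the polynomials over \<open>F\<close> that vanish at \<open>r\<close>.\<close>
  define F' where "F' = (\<lambda>p. poly p r) ` polys_over F"
  \<comment> \<open>The representing polynomial is an arbitrary choice; by \<open>vanish\<close> the
    value at \<open>s\<close> does not depend on it.\<close>
  define \<sigma>' where "\<sigma>' z = poly (map_poly \<sigma> (SOME p. p \<in> polys_over F \<and> poly p r = z)) s" for z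
  have vanish: "poly (map_poly \<sigma> p) s = 0" if p: "p \<in> polys_over F" "poly p r = 0" for p
  proof -
    obtain q t where qt: "q \<in> polys_over F" "t \<in> polys_over F" "p = m * q + t" "t = 0 \<or> degree t < degree m"
      using polys_over_division[OF F m(1,2) p(1)] by metis
    have "poly t r = 0" using p(2) m(3) qt(3) by simp
    hence "t = 0" using min[OF qt(2)] qt(4) by force
    thus ?thesis using qt s hom_poly_mult[OF F \<sigma> m(1) qt(1)] by simp
  qed
  have \<sigma>': "\<sigma>' (poly p r) = poly (map_poly \<sigma> p) s" if p: "p \<in> polys_over F" for p
  proof -
    define q where "q = (SOME q. q \<in> polys_over F \<and> poly q r = poly p r)"
    have q: "q \<in> polys_over F" "poly q r = poly p r"
      using someI[of "\<lambda>q. q \<in> polys_over F \<and> poly q r = poly p r" p] p by (auto simp: q_def)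
    have "poly (map_poly \<sigma> (p - q)) s = 0" using vanish[of "p - q"] p q by auto
    thus ?thesis using hom_poly_diff[OF F \<sigma> p q(1)] by (simp add: \<sigma>'_def q_def)
  qed
  \<comment> \<open>Euclidean descent: \<open>m = p * q + t\<close> gives
    \<open>poly p r * poly q r = - poly t r\<close> with \<open>t\<close> of smaller degree than
    \<open>p\<close>, and \<open>poly q r\<close> is nonzero because \<open>q\<close> has smaller
    degree than \<open>m\<close>. An inverse of \<open>poly t r\<close> thus yields one of
    \<open>poly p r\<close>.\<close>
  have inv: "\<exists>w\<in>polys_over F. poly w r * poly p r = 1"
    if "p \<in> polys_over F" "poly p r \<noteq> 0" "degree p < degree m \<or> degree p = 0" for p
    using that
  proof (induction "degree p" arbitrary: p rule: less_induct)
    case less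
    show ?case
    proof (cases "degree p = 0")
      case True
      then obtain c where c: "p = [:c:]" by (metis degree_eq_zeroE)
      hence "c \<in> F" using less(2) unfolding polys_over_def by (metis coeff_pCons_0 mem_Collect_eq)
      thus ?thesis using c less(3) subfield_inverse[OF F]
        by (intro bexI[of _ "[:inverse c:]"]) (auto)
    next
      case False
      have "p \<noteq> 0" using less(3) by auto
      then obtain q t where qt: "q \<in> polys_over F" "t \<in> polys_over F" "m = p * q + t" "t = 0 \<or> degree t < degree p"
        using polys_over_division[OF F less(2) _ m(1)] by metis
      have "q \<noteq> 0" using qt less(4) False m(2) by auto
      have "degree t < degree p" using qt(4) False by auto
      hence "degree m = degree p + degree q"
        using qt(3) \<open>p \<noteq> 0\<close> \<open>q \<noteq> 0\<close> by (simp add: degree_add_eq_left degree_mult_eq)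
      hence "poly q r \<noteq> 0" using min[OF qt(1) \<open>q \<noteq> 0\<close>] False by force
      have tr: "poly t r = - (poly p r * poly q r)"
        using m(3) qt(3) by (simp add: add_eq_0_iff2)
      hence "poly t r \<noteq> 0" using \<open>poly q r \<noteq> 0\<close> less(3) by simp
      then obtain w where w: "w \<in> polys_over F" "poly w r * poly t r = 1"
        using less(1)[of t] \<open>degree t < degree p\<close> qt(2) less(4) by auto
      show ?thesis
        using w tr qt(1) polys_over_const[OF F subfield_zero[OF F]]
        by (intro bexI[of _ "0 - w * q"] polys_over_diff[OF F] polys_over_mult[OF F])
           (auto simp: algebra_simps)
    qed
  qed
  have "subfield_C F'"
    unfolding subfield_C_def
  proof (intro conjI ballI)
    show "1 \<in> F'" unfolding F'_def
      using polys_over_const[OF F subfield_one[OF F]] by (intro image_eqI[of _ _ "[:1:]"]) auto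
    fix x assume "x \<in> F'"
    then obtain p where p: "p \<in> polys_over F" "x = poly p r" by (auto simp: F'_def)
    { fix y assume "y \<in> F'"
      then obtain q where q: "q \<in> polys_over F" "y = poly q r" by (auto simp: F'_def)
      show "x - y \<in> F'" unfolding F'_def using p q by (intro image_eqI[of _ _ "p - q"]) auto
      show "x * y \<in> F'" unfolding F'_def using p q by (intro image_eqI[of _ _ "p * q"]) auto }
    show "inverse x \<in> F'"
    proof (cases "x = 0")
      case True
      thus ?thesis unfolding F'_def
        using polys_over_const[OF F subfield_zero[OF F]] by (intro image_eqI[of _ _ "[:0:]"]) auto
    next
      case False
      obtain q t where qt: "q \<in> polys_over F" "t \<in> polys_over F" "p = m * q + t" "t = 0 \<or> degree t < degree m"
        using polys_over_division[OF F m(1,2) p(1)] by metis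
      have "poly t r = x" using qt p m(3) by simp
      then obtain w where "w \<in> polys_over F" "poly w r * x = 1"
        using inv[OF qt(2)] qt(4) False by auto
      thus ?thesis unfolding F'_def using inverse_unique[of x "poly w r"]
        by (intro image_eqI[of _ _ w]) (auto simp: mult.commute)
    qed
  qed
  moreover have "hom_on F' \<sigma>'"
    unfolding hom_on_def
  proof (intro conjI ballI)
    show "\<sigma>' 1 = 1"
      using \<sigma>'[of "[:1:]"] polys_over_const[OF F subfield_one[OF F]] hom_one[OF F \<sigma>] hom_zero[OF F \<sigma>]
      by (simp add: map_poly_pCons)
    fix x y assume "x \<in> F'" "y \<in> F'"
    then obtain p q where p: "p \<in> polys_over F" "x = poly p r" and q: "q \<in> polys_over F" "y = poly q r"
      by (auto simp: F'_def)
    show "\<sigma>' (x + y) = \<sigma>' x + \<sigma>' y"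
      using \<sigma>'[OF p(1)] \<sigma>'[OF q(1)] \<sigma>'[OF polys_over_add[OF F p(1) q(1)]] p q
      by (simp add: hom_poly_add[OF F \<sigma>])
    show "\<sigma>' (x * y) = \<sigma>' x * \<sigma>' y"
      using \<sigma>'[OF p(1)] \<sigma>'[OF q(1)] \<sigma>'[OF polys_over_mult[OF F p(1) q(1)]] p q
      by (simp add: hom_poly_mult[OF F \<sigma>])
  qed
  moreover have \<sigma>'F: "x \<in> F'" "\<sigma>' x = \<sigma> x" if "x \<in> F" for x
  proof -
    have "map_poly \<sigma> [:x:] = [:\<sigma> x:]"
      by (rule poly_eqI) (simp add: hom_coeff[OF F \<sigma>] coeff_pCons hom_zero[OF F \<sigma>] split: nat.split)
    thus "x \<in> F'" "\<sigma>' x = \<sigma> x" using \<sigma>'[of "[:x:]"] polys_over_const[OF F that]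
      by (auto simp: F'_def intro!: image_eqI[of _ _ "[:x:]"])
  qed
  moreover have X: "[:0, 1:] \<in> polys_over F"
    by (intro polys_over_pCons[OF F] polys_over_const[OF F] subfield_zero[OF F] subfield_one[OF F])
  hence "r \<in> F'" unfolding F'_def by (intro image_eqI[of _ _ "[:0,1:]"]) auto
  moreover have "\<sigma>' r = s"
    using \<sigma>'[OF X] hom_one[OF F \<sigma>] hom_zero[OF F \<sigma>] by (simp add: map_poly_pCons)
  ultimately show ?thesis using that[of F' \<sigma>'] by blast
qed

lemma minimal_poly_over:
  assumes F: "subfield_C F" and r: "algebraic r"
  obtains m where "m \<in> polys_over F" "m \<noteq> 0" "poly m r = 0" "degree m > 0"
    "\<And>p. p \<in> polys_over F \<Longrightarrow> p \<noteq> 0 \<Longrightarrow> poly p r = 0 \<Longrightarrow> degree m \<le> degree p"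
proof -
  obtain p where p: "p \<noteq> 0" "poly (map_poly of_int p) r = 0"
    using algebraicE'[OF r] .
  have "map_poly of_int p \<in> polys_over F"
    by (auto simp: polys_over_def coeff_map_poly subfield_of_int[OF F])
  moreover have "map_poly of_int p \<noteq> (0 :: complex poly)" using p(1) by simp
  ultimately obtain m where m: "m \<in> polys_over F \<and> m \<noteq> 0 \<and> poly m r = 0"
    and min: "\<And>p. p \<in> polys_over F \<and> p \<noteq> 0 \<and> poly p r = 0 \<Longrightarrow> degree m \<le> degree p"
    using p(2) ex_has_least_nat[of "\<lambda>p. p \<in> polys_over F \<and> p \<noteq> 0 \<and> poly p r = 0" _ degree] by metis
  have "degree m > 0"
    using m by (metis degree_eq_zeroE gr0I mult_zero_right pCons_0_0 poly_0 poly_const_conv)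
  thus ?thesis using that m min by blast
qed

text \<open>The elements of \<open>R\<close> are adjoined one at a time. Applying the embedding to
  the minimal polynomial of \<open>r\<close> preserves its degree, so the result has a complex root,
  which serves as the image of \<open>r\<close>.\<close>

lemma hom_extend:
  assumes "finite R" "\<And>r. r \<in> R \<Longrightarrow> algebraic r" "subfield_C F" "hom_on F \<sigma>"
  obtains F' \<sigma>' where "subfield_C F'" "hom_on F' \<sigma>'" "F \<subseteq> F'" "R \<subseteq> F'"
    "\<And>x. x \<in> F \<Longrightarrow> \<sigma>' x = \<sigma> x"
  using assms
proof (induction R arbitrary: thesis rule: finite_induct)
  case empty
  thus ?case by blast
next
  case (insert r R)
  obtain F1 \<sigma>1 where 1: "subfield_C F1" "hom_on F1 \<sigma>1" "F \<subseteq> F1" "R \<subseteq> F1" "\<And>x. x \<in> F \<Longrightarrow> \<sigma>1 x = \<sigma> x"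
    using insert by (metis insertI2)
  obtain m where m: "m \<in> polys_over F1" "m \<noteq> 0" "poly m r = 0" "degree m > 0"
    "\<And>p. p \<in> polys_over F1 \<Longrightarrow> p \<noteq> 0 \<Longrightarrow> poly p r = 0 \<Longrightarrow> degree m \<le> degree p"
    using minimal_poly_over[OF 1(1)] insert.prems(2) by (metis insertI1)
  have "degree (map_poly \<sigma>1 m) = degree m"
    by (rule degree_map_poly) (use m(1) hom_eq_0_iff[OF 1(1,2)] in \<open>auto simp: polys_over_def\<close>)
  then obtain s where s: "poly (map_poly \<sigma>1 m) s = 0"
    using m(4) fundamental_theorem_of_algebra_alt
      by (metis degree_0 degree_pCons_0 less_numeral_extra(3))
  obtain F' \<sigma>' where F': "subfield_C F'" "hom_on F' \<sigma>'" "F1 \<subseteq> F'" "r \<in> F'" "\<sigma>' r = s"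
      "\<And>x. x \<in> F1 \<Longrightarrow> \<sigma>' x = \<sigma>1 x"
    by (rule hom_extend_simple[OF 1(1,2) m(1-3) m(5) s]) (assumption | blast)+
  show ?case by (rule insert.prems(1)[OF F'(1,2)]) (use F' 1 in auto)
qed

lemma subfield_Rats: "subfield_C \<rat>"
  by (auto simp: subfield_C_def)

text \<open>Separability in characteristic zero. In \<open>m = [:-x, 1:] * q\<close> the factor
  \<open>q\<close> is not constant, as \<open>x\<close> is irrational, so it has a root. Were this
  root \<open>x\<close>, the derivative of \<open>m\<close> would vanish at \<open>x\<close> and
  have smaller degree.\<close>

lemma Rats_conjugate_ne:
  assumes m: "m \<in> polys_over \<rat>" "m \<noteq> 0" "poly m x = 0"
    and min: "\<And>p. p \<in> polys_over \<rat> \<Longrightarrow> p \<noteq> 0 \<Longrightarrow> poly p x = 0 \<Longrightarrow> degree m \<le> degree p"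
    and x: "x \<notin> \<rat>"
  obtains y where "poly m y = 0" "y \<noteq> x"
proof -
  obtain q where q: "m = [:-x, 1:] * q" using m(3) by (metis dvdE poly_eq_0_iff_dvd)
  have "q \<noteq> 0" using q m(2) by auto
  have "degree q \<noteq> 0"
  proof
    assume "degree q = 0"
    then obtain c where "q = [:c:]" by (metis degree_eq_zeroE)
    hence "m = [:- (x * c), c:]" "c \<noteq> 0" using q m(2) by auto
    hence "- (x * c) \<in> \<rat>" "c \<in> \<rat>" using m(1) unfolding polys_over_def
      by (metis (mono_tags) coeff_pCons_0 mem_Collect_eq, metis (mono_tags, lifting) coeff_pCons_0 coeff_pCons_Suc mem_Collect_eq)
    hence "- (- (x * c) / c) \<in> \<rat>" by (metis Rats_divide Rats_minus_iff)
    thus False using x \<open>c \<noteq> 0\<close> by simp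
  qed
  then obtain y where y: "poly q y = 0"
    using fundamental_theorem_of_algebra_alt by (metis degree_pCons_0)
  have "y \<noteq> x"
  proof
    assume "y = x"
    have "pderiv m \<in> polys_over \<rat>"
      using m(1) by (auto simp: polys_over_def coeff_pderiv)
    moreover have "poly (pderiv m) x = 0"
      using y \<open>y = x\<close> by (simp add: q pderiv_mult pderiv_pCons del: mult_pCons_left)
    moreover have "degree (pderiv m) < degree m" "pderiv m \<noteq> 0"
      using \<open>degree q \<noteq> 0\<close> q \<open>q \<noteq> 0\<close>
      by (auto simp: degree_pderiv pderiv_eq_0_iff degree_mult_eq simp del: mult_pCons_left)
    ultimately show False using min[of "pderiv m"] by simp
  qed
  thus ?thesis using that[of y] y q by simp
qed

section \<open>Minimal polynomials and Mahler measures\<close>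

abbreviation ipoly :: "int poly \<Rightarrow> complex poly" where
  "ipoly p \<equiv> map_poly of_int p"

lemma ipoly_mult: "ipoly (p * q) = ipoly p * ipoly q"
  by (rule of_int_poly_hom.hom_mult)

lemma ipoly_eq_0_iff: "ipoly p = 0 \<longleftrightarrow> p = 0"
  by simp

text \<open>Pseudo-division by an integer polynomial of least degree vanishing at \<open>x\<close>
  leaves a remainder that vanishes at \<open>x\<close>, hence is zero. The constant \<open>c\<close>
  is the price for staying over the integers.\<close>

lemma minimal_int_poly:
  assumes "q \<noteq> 0" "poly (ipoly q) x = 0"
  obtains m where "m \<noteq> 0" "poly (ipoly m) x = 0"
    "\<And>f. poly (ipoly f) x = 0 \<Longrightarrow> \<exists>c s. c \<noteq> 0 \<and> [:c:] * f = m * s"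
proof -
  obtain m where m: "m \<noteq> 0 \<and> poly (ipoly m) x = 0"
    and min: "\<And>p. p \<noteq> 0 \<and> poly (ipoly p) x = 0 \<Longrightarrow> degree m \<le> degree p"
    using assms ex_has_least_nat[of "\<lambda>m. m \<noteq> 0 \<and> poly (ipoly m) x = 0" q degree] by metis
  have "\<exists>c s. c \<noteq> 0 \<and> [:c:] * f = m * s" if f: "poly (ipoly f) x = 0" for f
  proof -
    obtain c s where cs: "c \<noteq> 0" "Polynomial.smult c f = m * s + pseudo_mod f m"
      using pseudo_mod(1)[of m f] m by blast
    have "ipoly ([:c:] * f) = ipoly (m * s + pseudo_mod f m)" using cs by simp
    hence "ipoly [:c:] * ipoly f = ipoly m * ipoly s + ipoly (pseudo_mod f m)"
      by (simp only: of_int_poly_hom.hom_mult of_int_poly_hom.hom_add)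
    hence "poly (ipoly [:c:] * ipoly f) x = poly (ipoly m * ipoly s + ipoly (pseudo_mod f m)) x"
      by (rule arg_cong)
    hence "poly (ipoly (pseudo_mod f m)) x = 0" using f m by (simp only: poly_mult poly_add) simp
    hence "pseudo_mod f m = 0" using min[of "pseudo_mod f m"] pseudo_mod(2)[of m f] m by force
    thus ?thesis using cs by (intro exI[of _ c] exI[of _ s]) simp
  qed
  thus ?thesis using that m by blast
qed

text \<open>Irreducible elements are prime in the factorial ring of integer polynomials. From
  \<open>[:c:] * p = m * s\<close> it follows that \<open>p\<close> divides \<open>m\<close>, since
  \<open>p dvd s\<close> would make \<open>m\<close> a divisor of a constant. Then \<open>p\<close>
  divides \<open>[:c:] * q\<close>, but not the constant.\<close>

lemma irreducible_dvd_if_common_root: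
  assumes p: "irreducible p" "poly (ipoly p) x = 0" and q: "poly (ipoly q) x = 0"
  shows "p dvd q"
proof -
  have "p \<noteq> 0" using p(1) by auto
  obtain m where m: "m \<noteq> 0" "poly (ipoly m) x = 0"
    "\<And>f. poly (ipoly f) x = 0 \<Longrightarrow> \<exists>c s. c \<noteq> 0 \<and> [:c:] * f = m * s"
    using minimal_int_poly[OF \<open>p \<noteq> 0\<close> p(2)] by metis
  have prime: "prime_elem p" using p(1) by (rule irreducible_imp_prime_elem)
  have nconst: "degree f > 0" if "f \<noteq> 0" "poly (ipoly f) x = 0" for f
    using that by (cases "degree f = 0") (auto elim!: degree_eq_zeroE simp: map_poly_pCons)
  have "p dvd m"
  proof -
    obtain c s where cs: "c \<noteq> 0" "[:c:] * p = m * s" using m(3)[OF p(2)] by blast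
    have "p dvd m * s" using cs(2) by (metis dvd_triv_right)
    moreover have False if ps: "p dvd s"
    proof -
      obtain t where "s = p * t" using ps by (elim dvdE)
      hence "[:c:] = m * t"
        using cs(2) \<open>p \<noteq> 0\<close> by (metis mult.commute mult.left_commute mult_cancel_left)
      moreover from this have "t \<noteq> 0" using cs(1) by auto
      ultimately have "degree [:c:] = degree m + degree t" using m(1) by (metis degree_mult_eq)
      thus False using nconst[OF m(1,2)] by simp
    qed
    ultimately show ?thesis using prime by (metis prime_elem_dvd_mult_iff)
  qed
  obtain c s where cs: "c \<noteq> 0" "[:c:] * q = m * s" using m(3)[OF q] by blast
  have "p dvd [:c:] * q" using \<open>p dvd m\<close> cs(2) by (metis dvd_mult2)
  moreover have "\<not> p dvd [:c:]"
    using nconst[OF \<open>p \<noteq> 0\<close> p(2)] cs(1) dvd_imp_degree_le[of p "[:c:]"] by auto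
  ultimately show ?thesis using prime prime_elem_dvd_mult_iff by blast
qed

lemma irreducible_int_poly_exists:
  assumes "f \<noteq> 0" "poly (ipoly f) x = 0"
  shows "\<exists>p. irreducible p \<and> lead_coeff p > 0 \<and> poly (ipoly p) x = 0"
proof -
  have "\<exists>p. irreducible p \<and> poly (ipoly p) x = 0" using assms
  proof (induction f rule: prime_divisors_induct)
    case (unit f)
    then obtain g where "1 = f * g" by blast
    hence "poly (ipoly 1) x = poly (ipoly f) x * poly (ipoly g) x" by (metis ipoly_mult poly_mult)
    thus ?case using unit by simp
  next
    case (factor p f)
    thus ?case by (metis ipoly_mult mult_eq_0_iff poly_mult prime_elem_imp_irreducible prime_imp_prime_elem)
  qed auto
  then obtain p where p: "irreducible p" "poly (ipoly p) x = 0" by blast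
  have "p \<noteq> 0" using p by auto
  show ?thesis
  proof (cases "lead_coeff p > 0")
    case False
    hence "lead_coeff (-1 * p) > 0" using \<open>p \<noteq> 0\<close> by (simp add: order_less_le)
    moreover have "irreducible (-1 * p)" using p(1) by (subst irreducible_mult_unit_left) auto
    moreover have "poly (ipoly (-1 * p)) x = 0" using p(2) by (simp only: ipoly_mult poly_mult) simp
    ultimately show ?thesis by blast
  qed (use p in blast)
qed

text \<open>The definite description is legitimate: two candidates divide each other, so they differ
  by a factor 1 or -1, and the positive leading coefficients exclude -1.\<close>

lemma min_poly_int_props:
  assumes "algebraic x"
  shows "irreducible (min_poly_int x)" "lead_coeff (min_poly_int x) > 0"
    "poly (ipoly (min_poly_int x)) x = 0"
proof -
  obtain f where "f \<noteq> 0" "poly (ipoly f) x = 0" using algebraicE'[OF assms] .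
  then obtain p where p: "irreducible p \<and> lead_coeff p > 0 \<and> poly (ipoly p) x = 0"
    using irreducible_int_poly_exists by blast
  have uniq: "q = p" if q: "irreducible q \<and> lead_coeff q > 0 \<and> poly (ipoly q) x = 0" for q
  proof -
    have pq: "p dvd q" and qp: "q dvd p" using irreducible_dvd_if_common_root p q by blast+
    obtain s where s: "q = p * s" using pq by (elim dvdE)
    obtain t where t: "p = q * t" using qp by (elim dvdE)
    note st = s t
    have nz: "p \<noteq> 0" "q \<noteq> 0" using p q by auto
    hence "1 = s * t" using st by (metis mult.assoc mult_cancel_left1)
    hence "degree s = 0"
      by (metis degree_1 degree_mult_eq mult_zero_left mult_zero_right add_is_0 one_neq_zero)
    then obtain a where a: "s = [:a:]" by (metis degree_eq_zeroE)
    have "is_unit s" using \<open>1 = s * t\<close> by (metis dvdI)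
    hence "is_unit a" using a by (simp add: is_unit_const_poly_iff)
    hence "\<bar>a\<bar> = 1" by (simp add: zdvd1_eq)
    moreover have "lead_coeff q = lead_coeff p * a" using st(1) a by (simp add: lead_coeff_mult)
    ultimately have "a = 1" using p q by (cases "a = -1") auto
    thus ?thesis using st(1) a by simp
  qed
  have "min_poly_int x = p" unfolding min_poly_int_def using p uniq by (rule the_equality)
  thus "irreducible (min_poly_int x)" "lead_coeff (min_poly_int x) > 0"
    "poly (ipoly (min_poly_int x)) x = 0" using p by auto
qed

section \<open>Mahler measures of polynomials and their discreteness\<close>

definition mahler :: "complex poly \<Rightarrow> real" where
  "mahler p = ln (cmod (lead_coeff p)) + (\<Sum>z\<in>#proots p. ln (max 1 (cmod z)))"

lemma log_mahler_eq: "log_mahler x = mahler (ipoly (min_poly_int x))"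
  by (simp add: log_mahler_def mahler_def)

lemma mahler_mult: "p \<noteq> 0 \<Longrightarrow> q \<noteq> 0 \<Longrightarrow> mahler (p * q) = mahler p + mahler q"
  by (simp add: mahler_def lead_coeff_mult proots_mult norm_mult ln_mult)

lemma mahler_ipoly_nonneg:
  assumes "p \<noteq> 0" shows "mahler (ipoly p) \<ge> 0"
proof -
  have "\<bar>lead_coeff p\<bar> \<ge> 1" using assms leading_coeff_0_iff[of p] by linarith
  hence "cmod (lead_coeff (ipoly p)) \<ge> 1" by simp
  moreover have "(\<Sum>z\<in>#A. ln (max 1 (cmod z))) \<ge> 0" for A by (induction A) auto
  ultimately show ?thesis unfolding mahler_def by (intro add_nonneg_nonneg) auto
qed

lemma log_mahler_nonneg: "algebraic x \<Longrightarrow> log_mahler x \<ge> 0"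
  unfolding log_mahler_eq using min_poly_int_props(1)[of x] by (intro mahler_ipoly_nonneg) auto

text \<open>The minimal polynomial divides \<open>p\<close>, and the cofactor is an integer
  polynomial, hence of nonnegative measure.\<close>

lemma log_mahler_le_mahler:
  assumes "p \<noteq> 0" "poly (ipoly p) x = 0"
  shows "log_mahler x \<le> mahler (ipoly p)"
proof -
  have x: "algebraic x" using assms by (intro algebraicI[of "ipoly p"]) (auto simp: coeff_map_poly)
  obtain q where q: "p = min_poly_int x * q"
    using irreducible_dvd_if_common_root[OF min_poly_int_props(1,3)[OF x] assms(2)] by blast
  hence "min_poly_int x \<noteq> 0" "q \<noteq> 0" using assms(1) by auto
  thus ?thesis using mahler_ipoly_nonneg[of q] by (simp add: log_mahler_eq q ipoly_mult mahler_mult)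
qed

lemma mahler_prod:
  "finite J \<Longrightarrow> (\<And>j. j \<in> J \<Longrightarrow> f j \<noteq> 0) \<Longrightarrow> mahler (\<Prod>j\<in>J. f j) = (\<Sum>j\<in>J. mahler (f j))"
  by (induction J rule: finite_induct) (auto simp: mahler_mult mahler_def[of 1])

lemma mahler_const_mult: "a \<noteq> 0 \<Longrightarrow> p \<noteq> 0 \<Longrightarrow> mahler (Polynomial.smult a p) = ln (cmod a) + mahler p"
  using mahler_mult[of "[:a:]" p] by (simp add: mahler_def[of "[:a:]"])

text \<open>Each of the \<open>d\<close> roots has the \<open>d\<close>-th root of
  \<open>cmod c\<close> as its modulus, so each contributes the same share
  \<open>ln (max 1 (cmod c)) / d\<close>.\<close>

lemma mahler_power_minus_const:
  assumes "d > 0" shows "mahler (monom 1 d - [:c:]) = ln (max 1 (cmod c))"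
proof -
  define p where "p = monom 1 d - [:c:]"
  have deg: "degree p = d"
    unfolding p_def diff_conv_add_uminus using assms
    by (subst degree_add_eq_left) (auto simp: degree_monom_eq)
  have lc: "lead_coeff p = 1" using assms deg by (cases d) (auto simp: p_def coeff_pCons)
  have "p \<noteq> 0" using lc by auto
  have root: "cmod z ^ d = cmod c" if "z \<in># proots p" for z
  proof -
    have "z ^ d = c" using that \<open>p \<noteq> 0\<close> by (simp add: p_def poly_monom)
    thus ?thesis by (metis norm_power)
  qed
  have ln: "ln (max 1 (cmod z)) = ln (max 1 (cmod c)) / d" if "z \<in># proots p" for z
  proof (cases "cmod z > 1")
    case True
    hence "cmod c > 1" using root[OF that] assms by (metis one_less_power)
    moreover have "ln (cmod c) = d * ln (cmod z)"
      unfolding root[OF that, symmetric] using True by (intro ln_realpow)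
    ultimately show ?thesis using True assms by (simp add: max_def)
  next
    case False
    hence "cmod c \<le> 1" using root[OF that] by (metis norm_ge_zero not_le power_le_one)
    thus ?thesis using False by (simp add: max_def)
  qed
  have "mahler p = (\<Sum>z\<in>#proots p. ln (max 1 (cmod c)) / d)"
    unfolding mahler_def lc by (simp add: ln cong: image_mset_cong)
  also have "\<dots> = ln (max 1 (cmod c))"
    using assms by (simp add: sum_mset_constant size_proots_complex deg)
  finally show ?thesis by (simp add: p_def)
qed

lemma mahler_linear: "mahler [:-c, 1:] = ln (max 1 (cmod c))"
  by (simp add: mahler_def)

text \<open>A further linear factor with root \<open>x\<close> multiplies a bound on the
  coefficients by at most \<open>1 + cmod x\<close>, which is at most
  \<open>2 * max 1 (cmod x)\<close>.\<close>

lemma cmod_coeff_le_mahler: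
  assumes "p \<noteq> 0"
  shows "cmod (coeff p i) \<le> 2 ^ degree p * exp (mahler p)"
proof -
  have *: "cmod (coeff (\<Prod>x\<in>#A. [:-x, 1:]) i) \<le> 2 ^ size A * exp (\<Sum>x\<in>#A. ln (max 1 (cmod x)))" for A i
  proof (induction A arbitrary: i)
    case (add x A)
    define q where "q = (\<Prod>x\<in>#A. [:-x, 1:])"
    define C where "C = 2 ^ size A * exp (\<Sum>x\<in>#A. ln (max 1 (cmod x)))"
    have q: "cmod (coeff q i) \<le> C" for i using add by (simp add: q_def C_def)
    have "C \<ge> 0" by (simp add: C_def)
    have "cmod (coeff (pCons 0 q) i) \<le> C" using q \<open>C \<ge> 0\<close> by (cases i) auto
    moreover have "cmod (x * coeff q i) \<le> cmod x * C"
      using q by (simp add: norm_mult mult_left_mono)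
    ultimately have "cmod (coeff ([:-x, 1:] * q) i) \<le> C + cmod x * C"
      using norm_triangle_ineq[of "- (x * coeff q i)" "coeff (pCons 0 q) i"] by simp
    also have "\<dots> \<le> 2 * max 1 (cmod x) * C"
      using \<open>C \<ge> 0\<close> mult_right_mono[of "1 + cmod x" "2 * max 1 (cmod x)" C]
        by (simp add: algebra_simps)
    finally show ?case by (simp add: q_def C_def exp_add mult_ac del: mult_pCons_left)
  qed (auto simp: coeff_1)
  have "p = Polynomial.smult (lead_coeff p) (\<Prod>x\<in>#proots p. [:-x, 1:])"
    by (rule complex_poly_decompose_multiset[symmetric])
  hence "cmod (coeff p i) = cmod (lead_coeff p) * cmod (coeff (\<Prod>x\<in>#proots p. [:-x, 1:]) i)"
    by (metis coeff_smult norm_mult)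
  also have "\<dots> \<le> cmod (lead_coeff p) * (2 ^ degree p * exp (\<Sum>x\<in>#proots p. ln (max 1 (cmod x))))"
    using *[of "proots p" i] by (intro mult_left_mono) (auto simp: size_proots_complex)
  also have "\<dots> = 2 ^ degree p * exp (mahler p)"
    using assms by (simp add: mahler_def exp_add)
  finally show ?thesis .
qed

lemma finite_bounded_int_polys:
  "finite {p :: int poly. degree p \<le> D \<and> (\<forall>i. \<bar>coeff p i\<bar> \<le> N)}"
proof (rule finite_subset)
  show "{p :: int poly. degree p \<le> D \<and> (\<forall>i. \<bar>coeff p i\<bar> \<le> N)} \<subseteq>
      Poly ` {xs. set xs \<subseteq> {-N..N} \<and> length xs = Suc D}"
  proof
    fix p :: "int poly" assume p: "p \<in> {p. degree p \<le> D \<and> (\<forall>i. \<bar>coeff p i\<bar> \<le> N)}"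
    have "p = Poly (map (coeff p) [0..<Suc D])"
      using p by (intro poly_eqI) (auto simp: nth_default_def coeff_eq_0 simp del: upt_Suc)
    moreover have "- N \<le> coeff p i \<and> coeff p i \<le> N" for i
      using p by (smt (verit) mem_Collect_eq)
    ultimately show "p \<in> Poly ` {xs. set xs \<subseteq> {-N..N} \<and> length xs = Suc D}"
      by (intro image_eqI[of _ _ "map (coeff p) [0..<Suc D]"]) (auto simp del: upt_Suc)
  qed
qed (auto intro!: finite_imageI finite_lists_length_eq)

definition mahler_values :: "nat \<Rightarrow> real set" where
  "mahler_values D = {mahler (ipoly p) | p. p \<noteq> 0 \<and> degree p \<le> D}"

text \<open>Northcott's argument: bounds on degree and measure bound the integer
  coefficients.\<close>

lemma finite_bounded_mahler_values: "finite {v \<in> mahler_values D. v \<le> B}"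
proof (rule finite_subset)
  define N where "N = \<lfloor>2 ^ D * exp B\<rfloor>"
  show "{v \<in> mahler_values D. v \<le> B} \<subseteq> (\<lambda>p. mahler (ipoly p)) ` {p. degree p \<le> D \<and> (\<forall>i. \<bar>coeff p i\<bar> \<le> N)}"
  proof
    fix v assume "v \<in> {v \<in> mahler_values D. v \<le> B}"
    then obtain p where p: "v = mahler (ipoly p)" "p \<noteq> 0" "degree p \<le> D" "v \<le> B"
      by (auto simp: mahler_values_def)
    have "\<bar>coeff p i\<bar> \<le> N" for i
    proof -
      have "\<bar>real_of_int (coeff p i)\<bar> = cmod (coeff (ipoly p) i)" by (simp add: coeff_map_poly)
      also have "\<dots> \<le> 2 ^ degree (ipoly p) * exp (mahler (ipoly p))"
        using p(2) by (intro cmod_coeff_le_mahler) simp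
      also have "\<dots> \<le> 2 ^ D * exp B" using p by (intro mult_mono power_increasing) auto
      finally show ?thesis unfolding N_def by linarith
    qed
    thus "v \<in> (\<lambda>p. mahler (ipoly p)) ` {p. degree p \<le> D \<and> (\<forall>i. \<bar>coeff p i\<bar> \<le> N)}" using p by blast
  qed
qed (auto intro: finite_bounded_int_polys)

lemma mahler_values_nonneg: "v \<in> mahler_values D \<Longrightarrow> v \<ge> 0"
  by (auto simp: mahler_values_def mahler_ipoly_nonneg)

section \<open>Galois groups\<close>

text \<open>Carries closure properties over from algebraic integers to algebraic numbers. The
  multiplier is the leading coefficient of an annihilating integer polynomial.\<close>

lemma algebraic_iff_multiple_algebraic_int:
  "algebraic z \<longleftrightarrow> (\<exists>n::int. n \<noteq> 0 \<and> algebraic_int (of_int n * z :: complex))"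
proof
  assume "algebraic z"
  then obtain p where p: "p \<noteq> 0" "poly (ipoly p) z = 0" by (rule algebraicE')
  have "degree (ipoly p) > 0"
    using p by (cases "degree p = 0") (auto elim!: degree_eq_zeroE simp: map_poly_pCons)
  moreover have "ipoly p \<in> polys_over (Collect algebraic_int)"
    by (auto simp: polys_over_def coeff_map_poly int_imp_algebraic_int)
  ultimately have "algebraic_int (lead_coeff (ipoly p) * z)"
    using p(2) by (intro lead_coeff_mult_root_algebraic_int)
  thus "\<exists>n::int. n \<noteq> 0 \<and> algebraic_int (of_int n * z)"
    using p(1) by (intro exI[of _ "lead_coeff p"]) auto
next
  assume "\<exists>n::int. n \<noteq> 0 \<and> algebraic_int (of_int n * z :: complex)"
  then obtain n :: int where n: "n \<noteq> 0" "algebraic_int (of_int n * z)" by blast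
  then obtain p where p: "p \<noteq> 0" "poly (ipoly p) (of_int n * z) = 0"
    using algebraicE'[OF algebraic_int_imp_algebraic[OF n(2)]] by metis
  define q where "q = pcompose p [:0, n:]"
  have "q \<noteq> 0" using p(1) n(1) by (auto simp: q_def pcompose_eq_0_iff)
  moreover have "poly (ipoly q) z = 0"
    using p(2) n(1)
      by (simp add: q_def of_int_hom.map_poly_pcompose poly_pcompose map_poly_pCons mult.commute)
  ultimately show "algebraic z"
    by (intro algebraicI[of "ipoly q"]) (auto simp: coeff_map_poly)
qed

lemma subfield_algebraic: "subfield_C (Collect algebraic)"
  unfolding subfield_C_def
proof (intro conjI ballI)
  show "1 \<in> Collect (algebraic :: complex \<Rightarrow> bool)"
    by (simp add: int_imp_algebraic_int algebraic_int_imp_algebraic)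
  fix x :: complex assume "x \<in> Collect algebraic"
  then show "inverse x \<in> Collect algebraic" by auto
  from \<open>x \<in> _\<close> obtain n :: int where n: "n \<noteq> 0" "algebraic_int (of_int n * x)"
    using algebraic_iff_multiple_algebraic_int by auto
  fix y :: complex assume "y \<in> Collect algebraic"
  then obtain k :: int where k: "k \<noteq> 0" "algebraic_int (of_int k * y)"
    using algebraic_iff_multiple_algebraic_int by auto
  have *: "algebraic_int (of_int i :: complex)" for i by (simp add: int_imp_algebraic_int)
  have "algebraic_int (of_int k * (of_int n * x) - of_int n * (of_int k * y))"
    by (rule algebraic_int_diff[OF algebraic_int_mult[OF * n(2)] algebraic_int_mult[OF * k(2)]])
  also have "of_int k * (of_int n * x) - of_int n * (of_int k * y) = of_int (k * n) * (x - y)"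
    by (simp add: algebra_simps)
  finally show "x - y \<in> Collect algebraic"
    using n k by (auto simp only: mem_Collect_eq algebraic_iff_multiple_algebraic_int mult_eq_0_iff intro!: exI[of _ "k * n"])
  have "algebraic_int ((of_int n * x) * (of_int k * y))"
    by (rule algebraic_int_mult[OF n(2) k(2)])
  also have "(of_int n * x) * (of_int k * y) = of_int (n * k) * (x * y)"
    by (simp add: algebra_simps)
  finally show "x * y \<in> Collect algebraic"
    using n k by (auto simp only: mem_Collect_eq algebraic_iff_multiple_algebraic_int mult_eq_0_iff intro!: exI[of _ "n * k"])
qed

lemma rational_poly_clear_denominators:
  assumes "p \<in> polys_over \<rat>"
  shows "\<exists>b q. b \<noteq> 0 \<and> ipoly q = Polynomial.smult (of_int b) p"
  using assms
proof (induction p rule: pCons_induct)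
  case 0
  show ?case by (intro exI[of _ 1] exI[of _ 0]) auto
next
  case (pCons c p)
  have cf: "coeff (pCons c p) i \<in> \<rat>" for i using pCons(3) by (auto simp: polys_over_def)
  have "p \<in> polys_over \<rat>" using cf[of "Suc _"] by (auto simp: polys_over_def)
  with pCons obtain b q where bq: "b \<noteq> 0" "ipoly q = Polynomial.smult (of_int b) p" by blast
  have "c \<in> \<rat>" using cf[of 0] by simp
  then obtain m n where mn: "n > 0" "c = of_int m / of_int n" by (auto elim!: Rats_cases')
  have "ipoly (pCons (m * b) (Polynomial.smult n q)) = Polynomial.smult (of_int (b * n)) (pCons c p)"
  proof (rule poly_eqI)
    fix i
    have "coeff (ipoly q) j = of_int b * coeff p j" for j using bq(2) by simp
    hence "of_int (coeff q j) = of_int b * coeff p j" for j by (simp add: coeff_map_poly)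
    thus "coeff (ipoly (pCons (m * b) (Polynomial.smult n q))) i =
      coeff (Polynomial.smult (of_int (b * n)) (pCons c p)) i"
      using mn by (cases i) (auto simp: coeff_map_poly)
  qed
  thus ?case using bq(1) mn(1)
    by (intro exI[of _ "b * n"] exI[of _ "pCons (m * b) (Polynomial.smult n q)"]) auto
qed

section \<open>The splitting field of an integer polynomial and its automorphism group\<close>

locale splitting =
  fixes \<Phi> :: "int poly" assumes \<Phi>: "\<Phi> \<noteq> 0"
begin

text \<open>
  Automorphisms of \<open>L\<close> are extended by the identity, so that they form a group under composition of
  functions.
\<close>

definition R :: "complex set" where "R = {z. poly (ipoly \<Phi>) z = 0}"
text \<open>The splitting field of \<Phi>. As an intersection it comes with an induction principle:
  a subset of \<open>L\<close> that contains \<open>R\<close> and is a subfield is all of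
  \<open>L\<close>.\<close>

definition L :: "complex set" where "L = \<Inter>{F. subfield_C F \<and> R \<subseteq> F}"
definition G :: "(complex \<Rightarrow> complex) set" where
  "G = {\<sigma>. hom_on L \<sigma> \<and> (\<forall>z. z \<notin> L \<longrightarrow> \<sigma> z = z)}"

lemma finite_R: "finite R"
  unfolding R_def using \<Phi> by (intro poly_roots_finite) simp

lemma R_subset_L: "R \<subseteq> L" by (auto simp: L_def)

lemma L_least: "subfield_C F \<Longrightarrow> R \<subseteq> F \<Longrightarrow> L \<subseteq> F" by (auto simp: L_def)

lemma subfield_L: "subfield_C L"
  by (auto simp: L_def subfield_C_def)

lemma R_algebraic: "z \<in> R \<Longrightarrow> algebraic z"
  unfolding R_def using \<Phi> by (intro algebraicI[of "ipoly \<Phi>"]) (auto simp: coeff_map_poly)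

lemma L_algebraic: "z \<in> L \<Longrightarrow> algebraic z"
  using L_least[OF subfield_algebraic] R_algebraic by auto

lemma G_hom: "\<sigma> \<in> G \<Longrightarrow> hom_on L \<sigma>" by (simp add: G_def)

lemma G_R: "\<sigma> \<in> G \<Longrightarrow> z \<in> R \<Longrightarrow> \<sigma> z \<in> R"
  using hom_int_root[OF subfield_L G_hom, of \<sigma> z \<Phi>] R_subset_L by (auto simp: R_def)

text \<open>The elements of \<open>L\<close> whose image lies in \<open>L\<close> form a subfield
  containing \<open>R\<close>.\<close>

lemma G_L: assumes "\<sigma> \<in> G" "z \<in> L" shows "\<sigma> z \<in> L"
proof -
  note h = G_hom[OF assms(1)]
  note [simp] = hom_one[OF subfield_L h] hom_diff[OF subfield_L h] hom_mult[OF subfield_L h]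
    hom_inverse[OF subfield_L h]
  have "subfield_C {z \<in> L. \<sigma> z \<in> L}"
    unfolding subfield_C_def by (auto simp: subfield_one[OF subfield_L] subfield_diff[OF subfield_L]
        subfield_mult[OF subfield_L] subfield_inverse[OF subfield_L])
  from L_least[OF this] show ?thesis using assms R_subset_L G_R by auto
qed

lemma G_inj: assumes "\<sigma> \<in> G" shows "inj \<sigma>"
proof (rule injI)
  fix x y assume xy: "\<sigma> x = \<sigma> y"
  have out: "\<sigma> z = z" if "z \<notin> L" for z using assms that by (simp add: G_def)
  show "x = y"
  proof (cases "x \<in> L"; cases "y \<in> L")
    assume "x \<in> L" "y \<in> L"
    thus ?thesis using xy hom_inj[OF subfield_L G_hom[OF assms]] by (meson inj_onD)
  qed (use xy out G_L[OF assms] in metis)+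
qed

lemma G_id: "id \<in> G" by (auto simp: G_def hom_on_def)

lemma G_comp: assumes "\<sigma> \<in> G" "\<tau> \<in> G" shows "\<sigma> \<circ> \<tau> \<in> G"
  using assms G_L[OF assms(2)] by (auto simp: G_def hom_on_def)

lemma G_eqI:
  assumes "\<sigma> \<in> G" "\<tau> \<in> G" "\<And>z. z \<in> R \<Longrightarrow> \<sigma> z = \<tau> z" shows "\<sigma> = \<tau>"
proof
  note h = G_hom[OF assms(1)] and k = G_hom[OF assms(2)]
  note [simp] = hom_one[OF subfield_L h] hom_diff[OF subfield_L h] hom_mult[OF subfield_L h]
    hom_inverse[OF subfield_L h] hom_one[OF subfield_L k] hom_diff[OF subfield_L k]
    hom_mult[OF subfield_L k] hom_inverse[OF subfield_L k]
  have "subfield_C {z \<in> L. \<sigma> z = \<tau> z}"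
    unfolding subfield_C_def by (auto simp: subfield_one[OF subfield_L] subfield_diff[OF subfield_L]
        subfield_mult[OF subfield_L] subfield_inverse[OF subfield_L])
  from L_least[OF this] have "\<sigma> z = \<tau> z" if "z \<in> L" for z using that assms(3) R_subset_L by auto
  thus "\<sigma> z = \<tau> z" for z using assms(1,2) by (cases "z \<in> L") (auto simp: G_def)
qed

text \<open>An automorphism is determined by its action on the finitely many roots.\<close>

lemma finite_G: "finite G"
proof (rule inj_on_finite)
  show "inj_on (\<lambda>\<sigma>. restrict \<sigma> R) G"
    by (intro inj_onI G_eqI) (auto simp: restrict_def fun_eq_iff, metis)
  show "(\<lambda>\<sigma>. restrict \<sigma> R) ` G \<subseteq> R \<rightarrow>\<^sub>E R" using G_R by auto
  show "finite (R \<rightarrow>\<^sub>E R)" using finite_R by (intro finite_PiE)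
qed

text \<open>Left composition with \<sigma> is an injective self-map of the finite set
  \<open>G\<close>, so it attains the identity.\<close>

lemma G_inverse:
  assumes "\<sigma> \<in> G" obtains \<tau> where "\<tau> \<in> G" "\<And>z. \<sigma> (\<tau> z) = z" "\<And>z. \<tau> (\<sigma> z) = z"
proof -
  have "(\<lambda>\<tau>. \<sigma> \<circ> \<tau>) ` G = G"
    using G_inj[OF assms] by (intro endo_inj_surj finite_G)
      (auto intro!: G_comp assms inj_onI simp: fun_eq_iff inj_eq)
  then obtain \<tau> where \<tau>: "\<tau> \<in> G" "\<sigma> \<circ> \<tau> = id" using G_id by (metis imageE)
  have 1: "\<sigma> (\<tau> z) = z" for z using \<tau>(2) by (metis comp_apply id_apply)
  have "\<tau> (\<sigma> z) = z" for z using 1 G_inj[OF assms] by (metis injD)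
  with 1 \<tau>(1) show ?thesis using that by blast
qed

lemma fixed_imp_Rats:
  assumes x: "x \<in> L" and fixed: "\<And>\<sigma>. \<sigma> \<in> G \<Longrightarrow> \<sigma> x = x"
  shows "x \<in> \<rat>"
proof (rule ccontr)
  assume nr: "x \<notin> \<rat>"
  obtain m where m: "m \<in> polys_over \<rat>" "m \<noteq> 0" "poly m x = 0"
    and min: "\<And>p. p \<in> polys_over \<rat> \<Longrightarrow> p \<noteq> 0 \<Longrightarrow> poly p x = 0 \<Longrightarrow> degree m \<le> degree p"
    using minimal_poly_over[OF subfield_Rats L_algebraic[OF x]] by metis
  obtain y where y: "poly m y = 0" "y \<noteq> x" using Rats_conjugate_ne[OF m min nr] by metis
  have hid: "hom_on \<rat> id" by (simp add: hom_on_def)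
  have y': "poly (map_poly id m) y = 0" using y by (simp add: map_poly_idI)
  obtain F1 \<sigma>1 where 1: "subfield_C F1" "hom_on F1 \<sigma>1" "\<rat> \<subseteq> F1" "x \<in> F1" "\<sigma>1 x = y"
      "\<And>z. z \<in> \<rat> \<Longrightarrow> \<sigma>1 z = id z"
    by (rule hom_extend_simple[OF subfield_Rats hid m min y']) (assumption | blast)+
  obtain F2 \<sigma>2 where 2: "subfield_C F2" "hom_on F2 \<sigma>2" "F1 \<subseteq> F2" "R \<subseteq> F2" "\<And>z. z \<in> F1 \<Longrightarrow> \<sigma>2 z = \<sigma>1 z"
    using hom_extend[OF finite_R R_algebraic 1(1,2)] by metis
  define \<sigma> where "\<sigma> z = (if z \<in> L then \<sigma>2 z else z)" for z
  have "L \<subseteq> F2" using L_least 2 by blast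
  hence "\<sigma> \<in> G" unfolding G_def hom_on_def \<sigma>_def
    using hom_one[OF 2(1,2)] hom_add[OF 2(1,2)] hom_mult[OF 2(1,2)]
    by (auto simp: subfield_one[OF subfield_L] subfield_add[OF subfield_L] subfield_mult[OF subfield_L] subset_iff)
  from fixed[OF this] show False using 1 2 x y by (simp add: \<sigma>_def)
qed

text \<open>\<open>G\<close> permutes the linear factors and so fixes every coefficient. The family
  is indexed in order to allow equal values at different indices, as may occur for the products of
  different blocks.\<close>

lemma invariant_prod_rational:
  assumes I: "finite I" "\<And>i. i \<in> I \<Longrightarrow> \<delta> i \<in> L"
    and perm: "\<And>\<sigma>. \<sigma> \<in> G \<Longrightarrow> \<exists>\<pi>. bij_betw \<pi> I I \<and> (\<forall>i\<in>I. \<sigma> (\<delta> i) = \<delta> (\<pi> i))"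
  shows "(\<Prod>i\<in>I. [:- \<delta> i, 1:]) \<in> polys_over \<rat>"
proof -
  define q where "q = (\<Prod>i\<in>I. [:- \<delta> i, 1:])"
  have lin: "[:- \<delta> i, 1:] \<in> polys_over L" if "i \<in> I" for i
    using that I(2) by (intro polys_over_pCons[OF subfield_L] polys_over_const[OF subfield_L]
        subfield_uminus[OF subfield_L] subfield_one[OF subfield_L])
  have q: "q \<in> polys_over L" unfolding q_def by (intro polys_over_prod[OF subfield_L] lin)
  have "\<sigma> (coeff q k) = coeff q k" if \<sigma>: "\<sigma> \<in> G" for \<sigma> k
  proof -
    note h = subfield_L G_hom[OF \<sigma>]
    obtain \<pi> where \<pi>: "bij_betw \<pi> I I" "\<And>i. i \<in> I \<Longrightarrow> \<sigma> (\<delta> i) = \<delta> (\<pi> i)" using perm[OF \<sigma>] by blast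
    have "map_poly \<sigma> q = (\<Prod>i\<in>I. map_poly \<sigma> [:- \<delta> i, 1:])"
      unfolding q_def by (rule hom_poly_prod[OF h lin])
    also have "\<dots> = (\<Prod>i\<in>I. [:- \<delta> (\<pi> i), 1:])"
    proof (rule prod.cong[OF refl])
      fix i assume i: "i \<in> I"
      have "map_poly \<sigma> [:- \<delta> i, 1:] = [:\<sigma> (- \<delta> i), \<sigma> 1:]"
        by (simp add: map_poly_pCons hom_one[OF h] hom_zero[OF h])
      thus "map_poly \<sigma> [:- \<delta> i, 1:] = [:- \<delta> (\<pi> i), 1:]"
        using i \<pi>(2) I(2) by (simp add: hom_one[OF h] hom_uminus[OF h])
    qed
    also have "\<dots> = q" unfolding q_def by (rule prod.reindex_bij_betw[OF \<pi>(1)])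
    finally show ?thesis by (metis hom_coeff[OF h])
  qed
  thus ?thesis using q unfolding q_def[symmetric] polys_over_def by (auto intro: fixed_imp_Rats)
qed

section \<open>Galois orbits as root sets of irreducible polynomials\<close>

definition orb :: "complex \<Rightarrow> complex set" where "orb a = (\<lambda>\<sigma>. \<sigma> a) ` G"

lemma finite_orb: "finite (orb a)" by (simp add: orb_def finite_G)

lemma orb_R: "a \<in> R \<Longrightarrow> orb a \<subseteq> R" by (auto simp: orb_def G_R)

lemma G_orb: assumes "\<sigma> \<in> G" shows "bij_betw \<sigma> (orb a) (orb a)"
proof -
  have inj: "inj_on \<sigma> (orb a)" using G_inj[OF assms] by (rule inj_on_subset) simp
  moreover have "\<sigma> ` orb a \<subseteq> orb a"
    using G_comp[OF assms] unfolding orb_def by (auto intro!: image_eqI[where x = "\<sigma> \<circ> _"])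
  ultimately show ?thesis using endo_inj_surj[OF finite_orb] by (simp add: bij_betw_def)
qed

text \<open>The orbit polynomial \<open>q\<close> has simple roots and rational coefficients, so
  \<open>f\<close> divides an integer multiple of it. Conversely, automorphisms map the root
  \<open>a\<close> of \<open>f\<close> to roots of \<open>f\<close>.\<close>

lemma proots_irreducible:
  assumes f: "irreducible f" "poly (ipoly f) a = 0" and a: "a \<in> R"
  shows "proots (ipoly f) = mset_set (orb a)"
proof -
  define q where "q = (\<Prod>c\<in>orb a. [:- c, 1:])"
  have "f \<noteq> 0" using f by auto
  have "q \<in> polys_over \<rat>" unfolding q_def
    using a orb_R R_subset_L G_orb by (intro invariant_prod_rational finite_orb) blast+
  then obtain b Q where bQ: "b \<noteq> 0" "ipoly Q = Polynomial.smult (of_int b) q"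
    using rational_poly_clear_denominators by blast
  have "q \<noteq> 0" by (auto simp: q_def finite_orb)
  have pq: "proots q = mset_set (orb a)"
    unfolding q_def by (subst proots_prod) (auto simp: sum_multiset_singleton)
  have ao: "a \<in> orb a" unfolding orb_def using G_id by (intro image_eqI[of _ _ id]) auto
  hence "poly q a = 0" by (auto simp: q_def poly_prod finite_orb)
  hence "poly (ipoly Q) a = 0" using bQ by simp
  then obtain h where h: "Q = f * h" using irreducible_dvd_if_common_root[OF f] by (metis dvdE)
  have "ipoly Q \<noteq> 0" using bQ \<open>q \<noteq> 0\<close> by simp
  hence "h \<noteq> 0" using h by auto
  have "proots (ipoly Q) = proots (ipoly f) + proots (ipoly h)"
    unfolding h ipoly_mult using \<open>f \<noteq> 0\<close> \<open>h \<noteq> 0\<close> by (intro proots_mult) auto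
  moreover have "proots (ipoly Q) = mset_set (orb a)" using bQ pq by simp
  ultimately have sub: "proots (ipoly f) \<subseteq># mset_set (orb a)" by (metis mset_subset_eq_add_left)
  have "poly (ipoly f) c = 0" if "c \<in> orb a" for c
    using that hom_int_root[OF subfield_L G_hom _ f(2)] a R_subset_L by (auto simp: orb_def)
  hence "orb a \<subseteq> set_mset (proots (ipoly f))" using \<open>f \<noteq> 0\<close> by auto
  hence "mset_set (orb a) \<subseteq># proots (ipoly f)"
    by (intro mset_subset_eqI) (auto simp: count_mset_set' finite_orb Suc_le_eq subset_iff)
  with sub show ?thesis by (metis subset_mset.antisym)
qed

end

section \<open>Replacing the factors of a factorization\<close>

text \<open>Blocks are contracted one after another. The cofactor \<open>v\<close> is arbitrary so
  that it can carry the linear factors of one block while the others are treated.\<close>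

lemma contract_blocks_algebraic_int:
  fixes v :: "complex poly"
  assumes "finite BB" "\<And>B. B \<in> BB \<Longrightarrow> finite B" "disjoint BB"
    and "v * (\<Prod>c\<in>\<Union>BB. [:-c, 1:]) \<in> polys_over (Collect algebraic_int)"
  shows "v * (\<Prod>B\<in>BB. [:- \<Prod>B, 1:]) \<in> polys_over (Collect algebraic_int)"
  using assms
proof (induction BB arbitrary: v rule: finite_induct)
  case (insert B BB)
  have "B \<inter> \<Union>BB = {}"
    using insert(2,5) by (auto simp: pairwise_insert disjnt_def pairwise_def)
  hence "(\<Prod>c\<in>\<Union>(insert B BB). [:-c, 1:]) = (\<Prod>c\<in>B. [:-c, 1:]) * (\<Prod>c\<in>\<Union>BB. [:-c, 1:])"
    using insert(1,4) by (subst Union_insert, subst prod.union_disjoint) auto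
  hence "v * (\<Prod>c\<in>B. [:-c, 1:]) * (\<Prod>c\<in>\<Union>BB. [:-c, 1:]) \<in> polys_over (Collect algebraic_int)"
    using insert(6) by (simp add: mult.assoc)
  hence "v * (\<Prod>c\<in>B. [:-c, 1:]) * (\<Prod>B\<in>BB. [:- \<Prod>B, 1:]) \<in> polys_over (Collect algebraic_int)"
    using insert(4,5) by (intro insert.IH) (auto simp: pairwise_insert)
  hence "v * (\<Prod>B\<in>BB. [:- \<Prod>B, 1:]) * (\<Prod>c\<in>B. [:-c, 1:]) \<in> polys_over (Collect algebraic_int)"
    by (simp add: mult_ac)
  hence "v * (\<Prod>B\<in>BB. [:- \<Prod>B, 1:]) * [:- \<Prod>B, 1:] \<in> polys_over (Collect algebraic_int)"
    using insert(4) by (intro contract_linear_factors_algebraic_int) auto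
  moreover have "v * (\<Prod>B\<in>insert B BB. [:- \<Prod>B, 1:]) = v * (\<Prod>B\<in>BB. [:- \<Prod>B, 1:]) * [:- \<Prod>B, 1:]"
    using insert(1,2) by (simp add: mult_ac del: mult_pCons_left mult_pCons_right)
  ultimately show ?case by simp
qed auto

lemma ln_max_prod_le:
  "finite B \<Longrightarrow> ln (max 1 (cmod (\<Prod>B))) \<le> (\<Sum>c\<in>B. ln (max 1 (cmod c)))"
proof (induction B rule: finite_induct)
  case (insert c B)
  have "max 1 (cmod (c * \<Prod>B)) \<le> max 1 (cmod c) * max 1 (cmod (\<Prod>B))"
    unfolding norm_mult using mult_mono[of 1 "max 1 (cmod c)" 1 "max 1 (cmod (\<Prod>B))"]
      mult_mono[of "cmod c" "max 1 (cmod c)" "cmod (\<Prod>B)" "max 1 (cmod (\<Prod>B))"] by auto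
  hence "ln (max 1 (cmod (c * \<Prod>B))) \<le> ln (max 1 (cmod c) * max 1 (cmod (\<Prod>B)))"
    by (subst ln_le_cancel_iff) (auto simp: less_max_iff_disj intro!: mult_pos_pos)
  also have "\<dots> = ln (max 1 (cmod c)) + ln (max 1 (cmod (\<Prod>B)))"
    by (simp add: ln_mult less_max_iff_disj)
  finally show ?case using insert by simp
qed auto

lemma degree_prod_linear:
  "finite J \<Longrightarrow> degree (\<Prod>j\<in>J. [:- c j, 1 :: complex:]) = card J"
  by (subst degree_prod_sum_eq) auto

section \<open>Blocks of conjugates under a normal subgroup of the Galois group\<close>

locale splitting_subgroup = splitting +
  fixes C :: "complex set"
  assumes C_R: "C \<subseteq> R" and C_stable: "\<And>\<sigma> c. \<sigma> \<in> G \<Longrightarrow> c \<in> C \<Longrightarrow> \<sigma> c \<in> C"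
begin

text \<open>The Galois group of \<open>L\<close> over the field generated by \<open>C\<close>; it is
  normal in \<open>G\<close> because \<open>C\<close> is stable under \<open>G\<close>. In the
  application \<open>C\<close> consists of the conjugates of the factored number.\<close>

definition N :: "(complex \<Rightarrow> complex) set" where "N = {\<sigma> \<in> G. \<forall>c\<in>C. \<sigma> c = c}"

lemma N_G: "h \<in> N \<Longrightarrow> h \<in> G" by (simp add: N_def)
lemma finite_N: "finite N" using finite_G by (simp add: N_def)
lemma N_id: "id \<in> N" by (simp add: N_def G_id)
lemma N_comp: "h \<in> N \<Longrightarrow> k \<in> N \<Longrightarrow> h \<circ> k \<in> N" by (simp add: N_def G_comp)

lemma N_inverse:
  assumes "h \<in> N" obtains k where "k \<in> N" "\<And>z. h (k z) = z" "\<And>z. k (h z) = z"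
proof -
  obtain k where k: "k \<in> G" "\<And>z. h (k z) = z" "\<And>z. k (h z) = z"
    using G_inverse[OF N_G[OF assms]] by blast
  have "k c = c" if "c \<in> C" for c using assms that k(3)[of c] by (simp add: N_def)
  thus ?thesis using that[of k] k by (simp add: N_def)
qed

lemma N_conj:
  assumes "\<sigma> \<in> G" "\<tau> \<in> G" "\<And>z. \<sigma> (\<tau> z) = z" "h \<in> N"
  shows "\<sigma> \<circ> h \<circ> \<tau> \<in> N"
  using assms C_stable[OF assms(2)] by (auto simp: N_def intro!: G_comp)

definition block :: "complex \<Rightarrow> complex set" where "block a = (\<lambda>h. h a) ` N"
text \<open>The translates of the \<open>N\<close>-orbit of \<open>a\<close>; by normality they are
  the \<open>N\<close>-orbits of the conjugates of \<open>a\<close>.\<close>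

definition blocks :: "complex \<Rightarrow> complex set set" where "blocks a = (\<lambda>\<sigma>. \<sigma> ` block a) ` G"

lemma finite_block: "finite (block a)" by (simp add: block_def finite_N)
lemma finite_blocks: "finite (blocks a)" by (simp add: blocks_def finite_G)
lemma finite_blocks_mem: "B \<in> blocks a \<Longrightarrow> finite B" by (auto simp: blocks_def finite_block)
lemma a_block: "a \<in> block a" unfolding block_def using N_id by (intro image_eqI[of _ _ id]) auto
lemma block_blocks: "block a \<in> blocks a"
  unfolding blocks_def using G_id by (intro image_eqI[of _ _ id]) auto

lemma Union_blocks: "\<Union>(blocks a) = orb a"
proof
  show "\<Union>(blocks a) \<subseteq> orb a"
  proof
    fix x assume "x \<in> \<Union>(blocks a)"
    then obtain \<sigma> h where "\<sigma> \<in> G" "h \<in> N" "x = \<sigma> (h a)" by (auto simp: blocks_def block_def)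
    thus "x \<in> orb a" unfolding orb_def
      using G_comp[of \<sigma> h] N_G by (intro image_eqI[of _ _ "\<sigma> \<circ> h"]) auto
  qed
  show "orb a \<subseteq> \<Union>(blocks a)" using a_block by (auto simp: orb_def blocks_def)
qed

lemma block_translate_subset:
  assumes "\<sigma> \<in> G" "\<tau> \<in> G" "x \<in> \<sigma> ` block a" "x \<in> \<tau> ` block a"
  shows "\<sigma> ` block a \<subseteq> \<tau> ` block a"
proof
  fix y assume "y \<in> \<sigma> ` block a"
  then obtain h1 where h1: "h1 \<in> N" "y = \<sigma> (h1 a)" by (auto simp: block_def)
  obtain h h' where h: "h \<in> N" "x = \<sigma> (h a)" and h': "h' \<in> N" "x = \<tau> (h' a)"
    using assms by (auto simp: block_def)
  obtain k where k: "k \<in> N" "\<And>z. h (k z) = z" "\<And>z. k (h z) = z" using N_inverse[OF h(1)] by blast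
  obtain \<sigma>' where \<sigma>': "\<sigma>' \<in> G" "\<And>z. \<sigma> (\<sigma>' z) = z" "\<And>z. \<sigma>' (\<sigma> z) = z"
    using G_inverse[OF assms(1)] by blast
  obtain \<tau>' where \<tau>': "\<tau>' \<in> G" "\<And>z. \<tau> (\<tau>' z) = z" "\<And>z. \<tau>' (\<tau> z) = z"
    using G_inverse[OF assms(2)] by blast
  \<comment> \<open>This element of \<open>N\<close> maps \<open>x\<close> to \<open>y\<close>.
    Since \<open>x = \<tau> (h' a)\<close>, conjugation by \<open>\<tau>'\<close> pulls it inside
    \<tau>.\<close>
  have "\<sigma> \<circ> (h1 \<circ> k) \<circ> \<sigma>' \<in> N" by (rule N_conj[OF assms(1) \<sigma>'(1,2) N_comp[OF h1(1) k(1)]])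
  hence "\<tau>' \<circ> (\<sigma> \<circ> (h1 \<circ> k) \<circ> \<sigma>') \<circ> \<tau> \<in> N" by (rule N_conj[OF \<tau>'(1) assms(2) \<tau>'(3)])
  hence "\<tau>' \<circ> (\<sigma> \<circ> (h1 \<circ> k) \<circ> \<sigma>') \<circ> \<tau> \<circ> h' \<in> N" using h'(1) by (rule N_comp)
  moreover have "\<tau> ((\<tau>' \<circ> (\<sigma> \<circ> (h1 \<circ> k) \<circ> \<sigma>') \<circ> \<tau> \<circ> h') a) = y"
    using h(2) h'(2) h1(2) k(3) \<sigma>'(3) \<tau>'(2) by (metis comp_apply)
  ultimately show "y \<in> \<tau> ` block a" unfolding block_def by blast
qed

lemma disjoint_blocks: "disjoint (blocks a)"
proof (rule disjointI)
  fix A B assume AB: "A \<in> blocks a" "B \<in> blocks a" "A \<noteq> B"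
  obtain \<sigma> \<tau> where s: "\<sigma> \<in> G" "\<tau> \<in> G" "A = \<sigma> ` block a" "B = \<tau> ` block a"
    using AB by (auto simp: blocks_def)
  show "A \<inter> B = {}"
  proof (rule ccontr)
    assume "A \<inter> B \<noteq> {}"
    then obtain x where "x \<in> \<sigma> ` block a" "x \<in> \<tau> ` block a" using s by blast
    hence "A = B" using s block_translate_subset by (metis subset_antisym)
    thus False using AB by simp
  qed
qed

text \<open>Automorphisms that agree on \<open>C\<close> differ by an element of \<open>N\<close>
  and so yield the same translate of the block. The bound involves only \<open>C\<close>, which
  later makes it uniform over all factorizations.\<close>

lemma card_blocks: "card (blocks a) \<le> card (C \<rightarrow>\<^sub>E C)"
proof -
  define F where "F \<sigma> = \<sigma> ` block a" for \<sigma> :: "complex \<Rightarrow> complex"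
  have eq: "F \<sigma> \<subseteq> F \<tau>" if st: "\<sigma> \<in> G" "\<tau> \<in> G" "restrict \<sigma> C = restrict \<tau> C" for \<sigma> \<tau>
  proof -
    obtain \<tau>' where \<tau>': "\<tau>' \<in> G" "\<And>z. \<tau> (\<tau>' z) = z" "\<And>z. \<tau>' (\<tau> z) = z"
      using G_inverse[OF st(2)] by blast
    have "\<sigma> c = \<tau> c" if "c \<in> C" for c using st(3) that by (metis restrict_apply')
    hence n: "\<tau>' \<circ> \<sigma> \<in> N" unfolding N_def using G_comp[OF \<tau>'(1) st(1)] \<tau>'(3) by auto
    have "\<sigma> (h a) = \<tau> ((\<tau>' \<circ> \<sigma> \<circ> h) a)" for h using \<tau>'(2) by simp
    thus ?thesis using N_comp[OF n] unfolding F_def block_def by blast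
  qed
  have "card (blocks a) \<le> card ((\<lambda>\<sigma>. restrict \<sigma> C) ` G)"
  proof (rule surj_card_le)
    show "finite ((\<lambda>\<sigma>. restrict \<sigma> C) ` G)" using finite_G by simp
    show "blocks a \<subseteq> (\<lambda>r. F (SOME \<sigma>. \<sigma> \<in> G \<and> restrict \<sigma> C = r)) ` (\<lambda>\<sigma>. restrict \<sigma> C) ` G"
    proof
      fix B assume "B \<in> blocks a"
      then obtain \<sigma> where s: "\<sigma> \<in> G" "B = F \<sigma>" by (auto simp: blocks_def F_def)
      define \<tau> where "\<tau> = (SOME \<tau>. \<tau> \<in> G \<and> restrict \<tau> C = restrict \<sigma> C)"
      have "\<tau> \<in> G \<and> restrict \<tau> C = restrict \<sigma> C" unfolding \<tau>_def
        by (rule someI[of "\<lambda>\<tau>. \<tau> \<in> G \<and> restrict \<tau> C = restrict \<sigma> C" \<sigma>]) (use s in simp)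
      hence "F \<tau> = F \<sigma>" using eq[of \<sigma> \<tau>] eq[of \<tau> \<sigma>] s(1) by auto
      thus "B \<in> (\<lambda>r. F (SOME \<sigma>. \<sigma> \<in> G \<and> restrict \<sigma> C = r)) ` (\<lambda>\<sigma>. restrict \<sigma> C) ` G"
        using s unfolding \<tau>_def by blast
    qed
  qed
  also have "\<dots> \<le> card (C \<rightarrow>\<^sub>E C)"
    using C_stable finite_subset[OF C_R finite_R] by (intro card_mono finite_PiE) auto
  finally show ?thesis .
qed

lemma G_blocks: assumes "\<sigma> \<in> G" shows "bij_betw (image \<sigma>) (blocks a) (blocks a)"
proof -
  have "inj_on (image \<sigma>) (blocks a)"
    using G_inj[OF assms] by (auto intro!: inj_onI simp: inj_image_eq_iff)
  moreover have "image \<sigma> ` blocks a \<subseteq> blocks a"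
  proof
    fix B assume "B \<in> image \<sigma> ` blocks a"
    then obtain \<tau> where "\<tau> \<in> G" "B = (\<sigma> \<circ> \<tau>) ` block a" by (auto simp: blocks_def image_comp)
    thus "B \<in> blocks a" unfolding blocks_def using G_comp[OF assms] by blast
  qed
  ultimately show ?thesis using endo_inj_surj[OF finite_blocks] by (simp add: bij_betw_def)
qed

text \<open>The fibres of \<open>h \<mapsto> h a\<close> over the block are cosets of the stabiliser
  of \<open>a\<close> in \<open>N\<close>, so they all have the same size \<open>s\<close>.\<close>

lemma prod_N_eq_power:
  obtains s where "card N = s * card (block a)" "(\<Prod>h\<in>N. h a) = (\<Prod>(block a)) ^ s"
proof -
  define s where "s = card {h \<in> N. h a = a}"
  have fib: "card {h \<in> N. h a = c} = s" if c: "c \<in> block a" for c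
  proof -
    obtain h0 where h0: "h0 \<in> N" "c = h0 a" using c by (auto simp: block_def)
    obtain k where k: "k \<in> N" "\<And>z. h0 (k z) = z" "\<And>z. k (h0 z) = z"
      using N_inverse[OF h0(1)] by blast
    have "bij_betw (\<lambda>h. h0 \<circ> h) {h \<in> N. h a = a} {h \<in> N. h a = c}"
    proof (rule bij_betw_byWitness[where f' = "\<lambda>h. k \<circ> h"])
      show "(\<lambda>h. h0 \<circ> h) ` {h \<in> N. h a = a} \<subseteq> {h \<in> N. h a = c}"
        by (clarsimp simp: h0 N_comp)
      show "(\<lambda>h. k \<circ> h) ` {h \<in> N. h a = c} \<subseteq> {h \<in> N. h a = a}"
        by (clarsimp simp: h0(2) k(1,3) N_comp)
    qed (simp_all add: fun_eq_iff k(2,3))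
    from bij_betw_same_card[OF this] show ?thesis by (simp add: s_def)
  qed
  have "card N = (\<Sum>c\<in>block a. card {h \<in> N. h a = c})"
    unfolding block_def using sum.image_gen[OF finite_N, of "\<lambda>_. 1::nat" "\<lambda>h. h a"] by simp
  hence 1: "card N = s * card (block a)" by (simp add: fib)
  have "(\<Prod>h\<in>N. h a) = (\<Prod>c\<in>block a. \<Prod>h\<in>{h \<in> N. h a = c}. h a)"
    unfolding block_def by (rule prod.image_gen[OF finite_N])
  also have "\<dots> = (\<Prod>c\<in>block a. c ^ s)" by (rule prod.cong) (auto simp flip: fib)
  also have "\<dots> = (\<Prod>(block a)) ^ s" by (simp add: prod_power_distrib)
  finally show ?thesis using that 1 by blast
qed

text \<open>The degree of \<open>P\<close> is bounded in terms of \<open>C\<close> alone, while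
  \<beta> is obtained only as a root of \<open>P\<close> composed with \<open>z ^ d\<close>, where
  \<open>d\<close> may be large. Hence the measure of \<open>P\<close> is kept as an intermediate
  value between those of \<beta> and \<open>f\<close>. The last equation lets the replacements of
  several factors be multiplied together.\<close>

lemma block_replacement:
  assumes f: "irreducible f" "poly (ipoly f) a = 0" and a: "a \<in> R" "a \<noteq> 0"
  obtains \<beta> P where "P \<noteq> 0" "degree P \<le> card (C \<rightarrow>\<^sub>E C)" "mahler (ipoly P) \<le> mahler (ipoly f)"
    "\<beta> \<noteq> 0" "algebraic \<beta>" "log_mahler \<beta> \<le> mahler (ipoly P)" "\<beta> ^ card N = (\<Prod>h\<in>N. h a)"
proof -
  define lc :: complex where "lc = lead_coeff (ipoly f)"
  have "f \<noteq> 0" using f by auto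
  hence lc: "lc \<noteq> 0" by (simp add: lc_def)
  have pf: "proots (ipoly f) = mset_set (orb a)" by (rule proots_irreducible[OF f a(1)])
  have orbL: "orb a \<subseteq> L" using orb_R[OF a(1)] R_subset_L by blast
  have f_eq: "ipoly f = Polynomial.smult lc (\<Prod>c\<in>orb a. [:-c, 1:])"
    using complex_poly_decompose_multiset[of "ipoly f"] pf
      by (simp add: lc_def prod_unfold_prod_mset)
  define q where "q = (\<Prod>B\<in>blocks a. [:- \<Prod>B, 1:])"
  have BL: "\<Prod>B \<in> L" if "B \<in> blocks a" for B
    using that Union_blocks[of a] orbL by (intro subfield_prod[OF subfield_L]) auto
  have rat: "q \<in> polys_over \<rat>" unfolding q_def
  proof (rule invariant_prod_rational[OF finite_blocks BL])
    fix \<sigma> assume s: "\<sigma> \<in> G"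
    have "\<sigma> (\<Prod>B) = \<Prod>(\<sigma> ` B)" if "B \<in> blocks a" for B
    proof -
      have "B \<subseteq> L" using that Union_blocks[of a] orbL by auto
      hence "\<sigma> (\<Prod>B) = (\<Prod>c\<in>B. \<sigma> c)" by (intro hom_prod[OF subfield_L G_hom[OF s]]) auto
      also have "\<dots> = \<Prod>(\<sigma> ` B)"
        using G_inj[OF s] by (subst prod.reindex) (auto intro: inj_on_subset)
      finally show ?thesis .
    qed
    thus "\<exists>\<pi>. bij_betw \<pi> (blocks a) (blocks a) \<and> (\<forall>B\<in>blocks a. \<sigma> (\<Prod>B) = \<Prod>(\<pi> B))"
      using G_blocks[OF s] by (intro exI[of _ "image \<sigma>"]) auto
  qed
  \<comment> \<open>Contracting each block to one linear factor keeps the coefficients integral;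
    being rational as well, they are integers.\<close>
  have "[:lc:] * (\<Prod>c\<in>\<Union>(blocks a). [:-c, 1:]) \<in> polys_over (Collect algebraic_int)"
    unfolding Union_blocks using f_eq[symmetric]
    by (auto simp: polys_over_def coeff_map_poly int_imp_algebraic_int)
  hence "[:lc:] * q \<in> polys_over (Collect algebraic_int)" unfolding q_def
    by (intro contract_blocks_algebraic_int finite_blocks disjoint_blocks finite_blocks_mem)
  hence "coeff (Polynomial.smult lc q) i \<in> \<int>" for i
    using rat by (intro rational_algebraic_int_is_int) (auto simp: polys_over_def lc_def)
  then obtain P where P: "Polynomial.smult lc q = ipoly P" by (rule intpolyE)
  have "q \<noteq> 0" by (auto simp: q_def finite_blocks)
  hence "P \<noteq> 0" using P lc by auto
  have "degree P = degree (ipoly P)" by simp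
  also have "\<dots> = card (blocks a)"
    unfolding P[symmetric] using lc by (simp add: q_def degree_prod_linear finite_blocks)
  finally have deg: "degree P \<le> card (C \<rightarrow>\<^sub>E C)" using card_blocks by simp
  have MP: "mahler (ipoly P) = ln (cmod lc) + (\<Sum>B\<in>blocks a. ln (max 1 (cmod (\<Prod>B))))"
    unfolding P[symmetric] using lc \<open>q \<noteq> 0\<close>
    by (simp add: mahler_const_mult q_def mahler_prod finite_blocks mahler_linear)
  have "(\<Sum>B\<in>blocks a. ln (max 1 (cmod (\<Prod>B)))) \<le> (\<Sum>B\<in>blocks a. \<Sum>c\<in>B. ln (max 1 (cmod c)))"
    by (intro sum_mono ln_max_prod_le finite_blocks_mem)
  also have "\<dots> = (\<Sum>c\<in>orb a. ln (max 1 (cmod c)))"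
    unfolding Union_blocks[symmetric] using disjoint_blocks[of a] finite_blocks_mem
    by (subst sum.Union_disjoint) (auto simp: pairwise_def disjnt_def)
  finally have MPf: "mahler (ipoly P) \<le> mahler (ipoly f)"
    unfolding MP by (simp add: mahler_def pf lc_def sum_unfold_sum_mset)
  define d where "d = card (block a)"
  have d: "d > 0" unfolding d_def using finite_block a_block by (metis card_gt_0_iff empty_iff)
  define \<delta> where "\<delta> = \<Prod>(block a)"
  have "h a \<noteq> 0" if "h \<in> N" for h
    using hom_eq_0_iff[OF subfield_L G_hom[OF N_G[OF that]]] a R_subset_L by auto
  hence "\<delta> \<noteq> 0" unfolding \<delta>_def by (auto simp: block_def finite_N)
  define \<beta> where "\<beta> = exp (Ln \<delta> / of_nat d)"
  have \<beta>d: "\<beta> ^ d = \<delta>" using d \<open>\<delta> \<noteq> 0\<close> unfolding \<beta>_def by (simp flip: exp_of_nat_mult)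
  \<comment> \<open>Substituting \<open>z ^ d\<close> makes \<beta> a root and does not change the
    measure, because \<open>z - c\<close> and \<open>z ^ d - c\<close> have the same one.\<close>
  define Pd where "Pd = pcompose P (monom 1 d)"
  have iPd: "ipoly Pd = pcompose (ipoly P) (monom 1 d)"
    by (simp add: Pd_def of_int_hom.map_poly_pcompose)
  have iPd2: "ipoly Pd = Polynomial.smult lc (\<Prod>B\<in>blocks a. monom 1 d - [:\<Prod>B:])"
  proof -
    have "pcompose [:- c, 1:] (monom 1 d) = monom 1 d - [:c:]" for c :: complex
      by (rule poly_eqI) (simp add: pcompose_pCons coeff_pCons split: nat.split)
    thus ?thesis unfolding iPd P[symmetric] q_def by (simp only: pcompose_smult pcompose_prod)
  qed
  have nz: "monom 1 d - [:c:] \<noteq> 0" for c :: complex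
  proof
    assume "monom 1 d - [:c:] = 0"
    hence "coeff (monom 1 d) d = coeff [:c:] d" by simp
    thus False using d by (cases d) (auto simp: coeff_pCons)
  qed
  have MPd: "mahler (ipoly Pd) = mahler (ipoly P)"
    unfolding iPd2 MP using lc nz d
    by (simp add: mahler_const_mult mahler_prod finite_blocks mahler_power_minus_const prod_zero_iff)
  have "Pd \<noteq> 0"
    using iPd2 lc nz finite_blocks by (metis (no_types, lifting) ipoly_eq_0_iff prod_zero_iff smult_eq_0_iff)
  have "poly q \<delta> = 0"
    unfolding q_def poly_prod
      using block_blocks[of a] finite_blocks by (auto simp: \<delta>_def intro!: prod_zero)
  hence "poly (ipoly Pd) \<beta> = 0" unfolding iPd by (simp add: poly_pcompose poly_monom \<beta>d flip: P)
  have alg: "algebraic \<beta>" using \<open>Pd \<noteq> 0\<close> \<open>poly (ipoly Pd) \<beta> = 0\<close>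
    by (intro algebraicI[of "ipoly Pd"]) (auto simp: coeff_map_poly)
  have le: "log_mahler \<beta> \<le> mahler (ipoly P)"
    using log_mahler_le_mahler[OF \<open>Pd \<noteq> 0\<close> \<open>poly (ipoly Pd) \<beta> = 0\<close>] MPd by simp
  obtain s where s: "card N = s * d" "(\<Prod>h\<in>N. h a) = \<delta> ^ s"
    unfolding d_def \<delta>_def by (rule prod_N_eq_power)
  have "\<beta> ^ card N = (\<Prod>h\<in>N. h a)" unfolding s using \<beta>d by (metis mult.commute power_mult)
  moreover have "\<beta> \<noteq> 0" by (simp add: \<beta>_def)
  ultimately show ?thesis using that \<open>P \<noteq> 0\<close> deg MPf alg le by blast
qed

end

text \<open>The polynomial \<open>z ^ n - 1\<close> annihilates \<zeta> and has measure 0;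
  nonnegativity does the rest.\<close>

lemma log_mahler_root_of_unity:
  assumes "\<zeta> ^ n = 1" "n > 0"
  shows "algebraic \<zeta>" "log_mahler \<zeta> = 0"
proof -
  define p :: "int poly" where "p = monom 1 n - [:1:]"
  have ip: "ipoly p = monom 1 n - [:1:]"
    unfolding p_def by (simp add: of_int_poly_hom.hom_minus map_poly_monom map_poly_pCons)
  have root: "poly (ipoly p) \<zeta> = 0" unfolding ip using assms by (simp add: poly_monom)
  have "coeff p n = 1" using assms(2) by (cases n) (auto simp: p_def coeff_pCons)
  hence "p \<noteq> 0" by auto
  show "algebraic \<zeta>"
    using \<open>p \<noteq> 0\<close> root by (intro algebraicI[of "ipoly p"]) (auto simp: coeff_map_poly)
  moreover have "log_mahler \<zeta> \<le> 0"
    using log_mahler_le_mahler[OF \<open>p \<noteq> 0\<close> root] mahler_power_minus_const[OF assms(2), of 1]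
    unfolding ip by simp
  ultimately show "log_mahler \<zeta> = 0" using log_mahler_nonneg by fastforce
qed

text \<open>The values \<open>vs\<close> lie between the new measures and the old ones and come from
  a set depending only on \<alpha>. The additional factor \<zeta> is the root of unity by which the
  new product is off.\<close>

lemma factorization_replacement:
  assumes \<alpha>: "algebraic \<alpha>"
  obtains D where "\<And>as. as \<in> factorizations \<alpha> \<Longrightarrow>
    \<exists>\<zeta> bs vs. \<zeta> # bs \<in> factorizations \<alpha> \<and> log_mahler \<zeta> = 0 \<and> set vs \<subseteq> mahler_values D \<and>
      list_all2 (\<lambda>b v. log_mahler b \<le> v) bs vs \<and> list_all2 (\<lambda>v a. v \<le> log_mahler a) vs as"
proof -
  define f0 where "f0 = min_poly_int \<alpha>"
  have f0: "irreducible f0" "poly (ipoly f0) \<alpha> = 0"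
    using min_poly_int_props[OF \<alpha>] by (auto simp: f0_def)
  have "f0 \<noteq> 0" using f0 by auto
  define C where "C = {z. poly (ipoly f0) z = 0}"
  \<comment> \<open>Bounds the number of blocks for every factor of every factorization.\<close>
  define D where "D = card (C \<rightarrow>\<^sub>E C)"
  have "\<exists>\<zeta> bs vs. \<zeta> # bs \<in> factorizations \<alpha> \<and> log_mahler \<zeta> = 0 \<and> set vs \<subseteq> mahler_values D \<and>
      list_all2 (\<lambda>b v. log_mahler b \<le> v) bs vs \<and> list_all2 (\<lambda>v a. v \<le> log_mahler a) vs as"
    if as: "as \<in> factorizations \<alpha>" for as
  proof -
    have alg: "\<And>a. a \<in> set as \<Longrightarrow> algebraic a" "\<And>a. a \<in> set as \<Longrightarrow> a \<noteq> 0" and pr: "prod_list as = \<alpha>"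
      using as by (auto simp: factorizations_def)
    have "\<alpha> \<noteq> 0" using alg(2)[of 0] pr by (auto simp: prod_list_zero_iff)
    \<comment> \<open>One splitting field for all the factors and the conjugates of \<alpha>; it
      varies with the factorization, unlike \<open>D\<close>.\<close>
    define \<Phi> where "\<Phi> = f0 * (\<Prod>a\<in>set as. min_poly_int a)"
    have mp: "irreducible (min_poly_int a)" "poly (ipoly (min_poly_int a)) a = 0" if "a \<in> set as" for a
      using min_poly_int_props alg that by auto
    have "min_poly_int a \<noteq> 0" if "a \<in> set as" for a using mp(1)[OF that] by auto
    hence "\<Phi> \<noteq> 0" using \<open>f0 \<noteq> 0\<close> by (auto simp: \<Phi>_def)
    then interpret splitting \<Phi> by unfold_locales
    have dvdR: "z \<in> R" if "g dvd \<Phi>" "poly (ipoly g) z = 0" for g z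
      using that by (auto simp: R_def ipoly_mult elim!: dvdE)
    have aR: "a \<in> R" if "a \<in> set as" for a
    proof (rule dvdR[OF _ mp(2)[OF that]])
      show "min_poly_int a dvd \<Phi>" unfolding \<Phi>_def using that by (intro dvd_mult dvd_prodI) auto
    qed
    have CR: "C \<subseteq> R" unfolding C_def using dvdR[of f0] by (auto simp: \<Phi>_def)
    interpret splitting_subgroup \<Phi> C
    proof
      show "C \<subseteq> R" by (rule CR)
      show "\<sigma> c \<in> C" if "\<sigma> \<in> G" "c \<in> C" for \<sigma> c
        using hom_int_root[OF subfield_L G_hom[OF that(1)], of c f0] that(2) CR R_subset_L
        by (auto simp: C_def)
    qed
    have "\<exists>\<beta> P. P \<noteq> 0 \<and> degree P \<le> D \<and> mahler (ipoly P) \<le> log_mahler a \<and> \<beta> \<noteq> 0 \<and> algebraic \<beta> \<and>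
      log_mahler \<beta> \<le> mahler (ipoly P) \<and> \<beta> ^ card N = (\<Prod>h\<in>N. h a)" if a: "a \<in> set as" for a
      using block_replacement[OF mp[OF a] aR[OF a] alg(2)[OF a]]
        unfolding D_def log_mahler_eq[of a] by metis
    then obtain \<beta> P where bP: "\<And>a. a \<in> set as \<Longrightarrow> P a \<noteq> 0 \<and> degree (P a) \<le> D \<and>
      mahler (ipoly (P a)) \<le> log_mahler a \<and> \<beta> a \<noteq> 0 \<and> algebraic (\<beta> a) \<and>
      log_mahler (\<beta> a) \<le> mahler (ipoly (P a)) \<and> \<beta> a ^ card N = (\<Prod>h\<in>N. h a)" by metis
    define b where "b = prod_list (map \<beta> as)"
    define \<zeta> where "\<zeta> = \<alpha> / b"
    have "b \<noteq> 0" using bP by (auto simp: b_def prod_list_zero_iff)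
    have \<alpha>C: "\<alpha> \<in> C" using f0 by (simp add: C_def)
    \<comment> \<open>The power becomes the product over \<open>h \<in> N\<close> of
      \<open>h \<alpha>\<close>, and \<open>h\<close> fixes \<alpha> as an element of
      \<open>C\<close>. So \<open>b\<close> and \<alpha> have the same \<open>card N\<close>-th
      power, and their quotient is a root of unity.\<close>
    have "b ^ card N = prod_list (map (\<lambda>a. \<beta> a ^ card N) as)"
      unfolding b_def by (induction as) (auto simp: power_mult_distrib)
    also have "\<dots> = prod_list (map (\<lambda>a. \<Prod>h\<in>N. h a) as)"
      using bP by (intro arg_cong[of _ _ prod_list] map_cong) auto
    also have "\<dots> = (\<Prod>h\<in>N. prod_list (map h as))"
      by (induction as) (auto simp: prod.distrib)
    also have "\<dots> = (\<Prod>h\<in>N. \<alpha>)"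
    proof (rule prod.cong[OF refl])
      fix h assume h: "h \<in> N"
      have "set as \<subseteq> L" using aR R_subset_L by blast
      hence "prod_list (map h as) = h \<alpha>"
        using hom_prod_list[OF subfield_L G_hom[OF N_G[OF h]], of as] pr by simp
      thus "prod_list (map h as) = \<alpha>" using h \<alpha>C by (simp add: N_def)
    qed
    finally have "\<zeta> ^ card N = 1" using \<open>b \<noteq> 0\<close> \<open>\<alpha> \<noteq> 0\<close> by (simp add: \<zeta>_def power_divide)
    moreover have "card N > 0" using finite_N N_id by (metis card_gt_0_iff empty_iff)
    ultimately have \<zeta>: "algebraic \<zeta>" "log_mahler \<zeta> = 0" using log_mahler_root_of_unity by blast+
    show ?thesis
    proof (intro exI conjI)
      show "\<zeta> # map \<beta> as \<in> factorizations \<alpha>"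
        using \<zeta> \<open>b \<noteq> 0\<close> \<open>\<alpha> \<noteq> 0\<close> bP unfolding factorizations_def
        by (auto simp: b_def[symmetric]) (auto simp: \<zeta>_def)
      show "set (map (\<lambda>a. mahler (ipoly (P a))) as) \<subseteq> mahler_values D"
        using bP by (auto simp: mahler_values_def)
      show "list_all2 (\<lambda>b v. log_mahler b \<le> v) (map \<beta> as) (map (\<lambda>a. mahler (ipoly (P a))) as)"
        using bP by (auto simp: list_all2_conv_all_nth)
      show "list_all2 (\<lambda>v a. v \<le> log_mahler a) (map (\<lambda>a. mahler (ipoly (P a))) as) as"
        using bP by (auto simp: list_all2_conv_all_nth)
    qed (rule \<zeta>)
  qed
  thus ?thesis using that by blast
qed

section \<open>Exponential sums and exceptional points\<close>

text \<open>For positive entries and \<open>t > 0\<close> this is the \<open>t\<close>-th power of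
  the norm. Without the outer root it is an exponential sum in \<open>t\<close>, which extends to an
  entire function.\<close>

definition pow_sum :: "real list \<Rightarrow> real \<Rightarrow> real" where
  "pow_sum v t = (\<Sum>x\<leftarrow>v. x powr t)"

text \<open>The difference of the two sums extends to an entire function, which has only finitely
  many zeros in a closed disc unless it is constant.\<close>

lemma pow_sum_coincidences:
  assumes "\<And>x. x \<in> set v \<Longrightarrow> x > 0" "\<And>x. x \<in> set w \<Longrightarrow> x > 0"
  shows "(\<forall>t. pow_sum v t = pow_sum w t) \<or> finite {t \<in> {0..T}. pow_sum v t = pow_sum w t}"
proof -
  define F where "F v z = (\<Sum>x\<leftarrow>v. exp (of_real (ln x) * z))" for v and z :: complex
  define f where "f z = F v z - F w z" for z
  have F: "F v (of_real t) = of_real (pow_sum v t)" if "\<And>x. x \<in> set v \<Longrightarrow> x > 0" for v t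
    using that unfolding F_def pow_sum_def
  proof (induction v)
    case (Cons x v)
    have "exp (complex_of_real (ln x) * of_real t) = of_real (x powr t)"
      using Cons.prems[of x] by (simp add: powr_def mult.commute flip: exp_of_real)
    thus ?case using Cons by simp
  qed simp
  have zero_iff: "f (of_real t) = 0 \<longleftrightarrow> pow_sum v t = pow_sum w t" for t
    using F[OF assms(1)] F[OF assms(2)] by (simp add: f_def)
  have "F v holomorphic_on UNIV" for v
    unfolding F_def by (induction v) (auto intro!: holomorphic_intros)
  hence holo: "f holomorphic_on UNIV" unfolding f_def by (intro holomorphic_intros)
  show ?thesis
  proof (cases "f constant_on UNIV")
    \<comment> \<open>A constant difference vanishes either everywhere or nowhere.\<close>
    case True
    then obtain c where "\<And>z. f z = c" by (auto simp: constant_on_def)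
    thus ?thesis using zero_iff by (cases "c = 0") auto
  next
    case False
    have fin: "finite {z \<in> cball 0 T. f z = 0}"
      by (rule holomorphic_compact_finite_zeros[OF holo _ _ _ _ False]) auto
    have "finite {t \<in> {0..T}. pow_sum v t = pow_sum w t}"
    proof (rule inj_on_finite[OF _ _ fin])
      show "inj_on complex_of_real {t \<in> {0..T}. pow_sum v t = pow_sum w t}" by (auto intro: inj_onI)
      show "complex_of_real ` {t \<in> {0..T}. pow_sum v t = pow_sum w t} \<subseteq> {z \<in> cball 0 T. f z = 0}"
        using zero_iff by auto
    qed
    thus ?thesis by blast
  qed
qed

lemma pow_sum_continuous:
  assumes "\<And>x. x \<in> set v \<Longrightarrow> x > 0" shows "(pow_sum v \<longlongrightarrow> pow_sum v s) (nhds s)"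
  using assms unfolding pow_sum_def
proof (induction v)
  case (Cons x v)
  have "((\<lambda>t. x powr t) \<longlongrightarrow> x powr s) (nhds s)"
    using Cons.prems[of x]
      by (intro tendsto_powr tendsto_const tendsto_ident_at filterlim_ident) auto
  with Cons show ?case by (auto intro!: tendsto_add)
qed auto

text \<open>\<open>E\<close> collects the crossing points of pairs that do not agree identically.
  Outside \<open>E\<close>, a sum minimal at \<open>s\<close> is strictly below every sum that is a
  different function, and by continuity it stays minimal nearby.\<close>

lemma finite_min_stable:
  assumes W: "finite W" "W \<noteq> {}" "\<And>v x. v \<in> W \<Longrightarrow> x \<in> set v \<Longrightarrow> x > 0"
  obtains E where "finite E"
    "\<And>s. s \<in> {0<..<T} - E \<Longrightarrow> \<exists>v\<in>W. \<exists>e>0. \<forall>t. \<bar>t - s\<bar> < e \<longrightarrow>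
        t \<in> {0<..<T} \<and> (\<forall>w\<in>W. pow_sum v t \<le> pow_sum w t)"
proof -
  define Z where "Z v w = {t \<in> {0..T}. pow_sum v t = pow_sum w t}" for v w
  \<comment> \<open>Pairs with infinitely many coincidences agree for all \<open>t\<close>, so they
    contribute no crossing points.\<close>
  define E where "E = (\<Union>v\<in>W. \<Union>w\<in>W. if finite (Z v w) then Z v w else {})"
  have "finite E" unfolding E_def using W(1) by auto
  moreover have "\<exists>v\<in>W. \<exists>e>0. \<forall>t. \<bar>t - s\<bar> < e \<longrightarrow>
        t \<in> {0<..<T} \<and> (\<forall>w\<in>W. pow_sum v t \<le> pow_sum w t)" if s: "s \<in> {0<..<T} - E" for s
  proof -
    obtain v where v: "v \<in> W" "\<And>w. w \<in> W \<Longrightarrow> pow_sum v s \<le> pow_sum w s"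
      using arg_min_if_finite[OF W(1,2), of "\<lambda>v. pow_sum v s"] by (metis not_le)
    have "eventually (\<lambda>t. pow_sum v t \<le> pow_sum w t) (nhds s)" if w: "w \<in> W" for w
    proof (cases "\<forall>t. pow_sum v t = pow_sum w t")
      case False
      hence "finite (Z v w)"
        using pow_sum_coincidences[of v w T] W(3) v(1) w unfolding Z_def by blast
      hence "Z v w \<subseteq> E" using v(1) w unfolding E_def by force
      hence "pow_sum v s \<noteq> pow_sum w s" using s by (auto simp: Z_def subset_iff)
      hence "0 < pow_sum w s - pow_sum v s" using v(2)[OF w] by simp
      moreover have "((\<lambda>t. pow_sum w t - pow_sum v t) \<longlongrightarrow> pow_sum w s - pow_sum v s) (nhds s)"
        using W(3) v(1) w by (intro tendsto_diff pow_sum_continuous) blast+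
      ultimately have "eventually (\<lambda>t. 0 < pow_sum w t - pow_sum v t) (nhds s)"
        by (metis order_tendstoD(1))
      thus ?thesis by (rule eventually_mono) simp
    qed simp
    hence "eventually (\<lambda>t. \<forall>w\<in>W. pow_sum v t \<le> pow_sum w t) (nhds s)"
      using W(1) by (intro eventually_ball_finite) auto
    moreover have "eventually (\<lambda>t. t \<in> {0<..<T}) (nhds s)"
      using s by (intro eventually_nhds_in_open) auto
    ultimately have "eventually (\<lambda>t. t \<in> {0<..<T} \<and> (\<forall>w\<in>W. pow_sum v t \<le> pow_sum w t)) (nhds s)"
      by (simp add: eventually_conj_iff)
    thus ?thesis using v(1) by (auto simp: eventually_nhds_metric dist_real_def)
  qed
  ultimately show ?thesis using that by blast
qed

lemma sum_list_mono_list_all2: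
  fixes f :: "'a \<Rightarrow> real"
  shows "list_all2 (\<lambda>x y. f x \<le> g y) xs ys \<Longrightarrow> (\<Sum>x\<leftarrow>xs. f x) \<le> (\<Sum>y\<leftarrow>ys. g y)"
  by (induction rule: list_all2_induct) auto

lemma pow_sum_filter_pos:
  assumes "\<And>x. x \<in> set v \<Longrightarrow> x \<ge> 0"
  shows "pow_sum (filter (\<lambda>x. x > 0) v) t = pow_sum v t"
  using assms unfolding pow_sum_def
  by (induction v) (auto simp: order_less_le)

lemma factorization_self: "algebraic \<alpha> \<Longrightarrow> \<alpha> \<noteq> 0 \<Longrightarrow> [\<alpha>] \<in> factorizations \<alpha>"
  by (simp add: factorizations_def)

text \<open>For \<open>t\<close> between 0 and \<open>T\<close>, minimising over the finite set
  \<open>W\<close> amounts to minimising over all factorizations; the last two properties are the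
  two inequalities.\<close>

lemma finite_value_lists:
  assumes \<alpha>: "algebraic \<alpha>" "\<alpha> \<noteq> 0" and T: "T > 0"
  obtains W where "finite W" "\<And>w x. w \<in> W \<Longrightarrow> x \<in> set w \<Longrightarrow> x > 0"
    "\<And>w. w \<in> W \<Longrightarrow> \<exists>as\<in>factorizations \<alpha>. \<forall>t>0. pow_sum (map log_mahler as) t \<le> pow_sum w t"
    "\<And>as t. as \<in> factorizations \<alpha> \<Longrightarrow> t \<in> {0<..<T} \<Longrightarrow> \<exists>w\<in>W. pow_sum w t \<le> pow_sum (map log_mahler as) t"
proof -
  obtain D where D: "\<And>as. as \<in> factorizations \<alpha> \<Longrightarrow>
    \<exists>\<zeta> bs vs. \<zeta> # bs \<in> factorizations \<alpha> \<and> log_mahler \<zeta> = 0 \<and> set vs \<subseteq> mahler_values D \<and>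
      list_all2 (\<lambda>b v. log_mahler b \<le> v) bs vs \<and> list_all2 (\<lambda>v a. v \<le> log_mahler a) vs as"
    using factorization_replacement[OF \<alpha>(1)] by metis
  \<comment> \<open>The measure of the trivial factorization \<open>[\<alpha>]\<close>, with which
    all others are compared.\<close>
  define B where "B = log_mahler \<alpha>"
  have "B \<ge> 0" unfolding B_def by (rule log_mahler_nonneg[OF \<alpha>(1)])
  define V where "V = {v \<in> mahler_values D. v \<le> B} \<inter> {0<..}"
  have finV: "finite V" unfolding V_def using finite_bounded_mahler_values by blast
  \<comment> \<open>The smallest positive value available. If \<open>V\<close> is empty,
    \<open>c\<close> is unspecified and the empty list is the only one to consider.\<close>
  define c where "c = Min V"
  have c: "0 < c" "c \<le> v" "c \<le> B" if "v \<in> V" for v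
  proof -
    have "c \<in> V" unfolding c_def using finV that by (intro Min_in) auto
    thus "0 < c" "c \<le> B" by (auto simp: V_def)
    show "c \<le> v" unfolding c_def using finV that by simp
  qed
  \<comment> \<open>If all entries are at least \<open>c\<close> and the sum at \<open>t\<close> is
    at most \<open>B powr t\<close>, the length is at most \<open>(B / c) powr t\<close>, and
    \<open>t < T\<close> with \<open>c \<le> B\<close> gives a bound independent of
    \<open>t\<close>.\<close>
  define n where "n = nat \<lfloor>(B / c) powr T\<rfloor>"
  define W where "W = {w. set w \<subseteq> V \<and> length w \<le> n \<and>
    (\<exists>as\<in>factorizations \<alpha>. \<forall>t>0. pow_sum (map log_mahler as) t \<le> pow_sum w t)}"
  have low: "\<exists>w\<in>W. pow_sum w t \<le> pow_sum (map log_mahler as) t"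
    if as: "as \<in> factorizations \<alpha>" and t: "t \<in> {0<..<T}"
      and le: "pow_sum (map log_mahler as) t \<le> B powr t" for as t
  proof -
    obtain \<zeta> bs vs where r: "\<zeta> # bs \<in> factorizations \<alpha>" "log_mahler \<zeta> = 0" "set vs \<subseteq> mahler_values D"
      "list_all2 (\<lambda>b v. log_mahler b \<le> v) bs vs" "list_all2 (\<lambda>v a. v \<le> log_mahler a) vs as"
      using D[OF as] by blast
    have vs0: "v \<ge> 0" if "v \<in> set vs" for v using r(3) that mahler_values_nonneg by blast
    have bs0: "log_mahler b \<ge> 0" if "b \<in> set bs" for b
      using r(1) that by (intro log_mahler_nonneg) (auto simp: factorizations_def)
    \<comment> \<open>Zeros are dropped so that the length can be bounded; they contribute
      \<open>0 powr t = 0\<close>.\<close>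
    define w where "w = filter (\<lambda>x. x > 0) vs"
    have w: "pow_sum w t = pow_sum vs t" for t unfolding w_def by (rule pow_sum_filter_pos[OF vs0])
    have upper: "pow_sum (map log_mahler (\<zeta> # bs)) t \<le> pow_sum w t" if "t > 0" for t
    proof -
      have "list_all2 (\<lambda>b v. log_mahler b powr t \<le> v powr t) bs vs"
        using r(4) bs0 that by (auto simp: list_all2_conv_all_nth intro!: powr_mono2)
      from sum_list_mono_list_all2[OF this] show ?thesis
        unfolding w by (simp add: pow_sum_def r(2) comp_def)
    qed
    have lower: "pow_sum w t \<le> pow_sum (map log_mahler as) t"
    proof -
      have "list_all2 (\<lambda>v a. v powr t \<le> log_mahler a powr t) vs as"
        using r(5) vs0 t by (auto simp: list_all2_conv_all_nth intro!: powr_mono2)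
      from sum_list_mono_list_all2[OF this] show ?thesis
        unfolding w by (simp add: pow_sum_def comp_def)
    qed
    have wV: "set w \<subseteq> V"
    proof
      fix v assume v: "v \<in> set w"
      hence "v \<in> set vs" "v > 0" by (auto simp: w_def)
      have "v powr t \<le> pow_sum w t"
        unfolding pow_sum_def using v by (intro member_le_sum_list) auto
      hence "v powr t \<le> B powr t" using lower le by simp
      hence "v \<le> B" using t \<open>v > 0\<close> \<open>B \<ge> 0\<close> powr_less_mono2[of t B v] by force
      thus "v \<in> V" using \<open>v \<in> set vs\<close> \<open>v > 0\<close> r(3) by (auto simp: V_def)
    qed
    have "length w \<le> n"
    proof (cases w)
      case (Cons x u)
      hence "x \<in> V" using wV by auto
      note c' = c(1,3)[OF this]
      have "real (length w) * c powr t = (\<Sum>x\<leftarrow>w. c powr t)" by (simp add: sum_list_triv)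
      also have "\<dots> \<le> pow_sum w t" unfolding pow_sum_def
        using wV c t c' by (intro sum_list_mono powr_mono2) auto
      also have "\<dots> \<le> B powr t" using lower le by simp
      finally have "real (length w) \<le> (B / c) powr t"
        using c' \<open>B \<ge> 0\<close> by (simp add: powr_divide field_simps)
      also have "\<dots> \<le> (B / c) powr T" using c' t by (intro powr_mono) auto
      finally show ?thesis unfolding n_def by linarith
    qed simp
    hence "w \<in> W" unfolding W_def using wV upper r(1) by blast
    thus ?thesis using lower by blast
  qed
  have "finite W"
    by (rule finite_subset[OF _ finite_lists_length_le[OF finV, of n]]) (auto simp: W_def)
  moreover have "x > 0" if "w \<in> W" "x \<in> set w" for w x using that by (auto simp: W_def V_def)
  moreover have "\<exists>as\<in>factorizations \<alpha>. \<forall>t>0. pow_sum (map log_mahler as) t \<le> pow_sum w t" if "w \<in> W" for w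
    using that by (simp add: W_def)
  moreover have "\<exists>w\<in>W. pow_sum w t \<le> pow_sum (map log_mahler as) t"
    if as: "as \<in> factorizations \<alpha>" and t: "t \<in> {0<..<T}" for as t
  proof (cases "pow_sum (map log_mahler as) t \<le> B powr t")
    case False
    \<comment> \<open>A factorization worse than the trivial one is undercut by the list obtained
      from the trivial one.\<close>
    have self: "pow_sum (map log_mahler [\<alpha>]) t = B powr t" by (simp add: pow_sum_def B_def)
    obtain w where "w \<in> W" "pow_sum w t \<le> B powr t"
      using low[OF factorization_self[OF \<alpha>] t] self by auto
    thus ?thesis using False by (intro bexI[of _ w]) auto
  qed (rule low[OF as t])
  ultimately show ?thesis using that by blast
qed

text \<open>The list is padded with zeros; positivity makes the support exactly the indices below
  its length.\<close>

lemma seq_norm_list: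
  assumes "\<And>x. x \<in> set v \<Longrightarrow> x > 0"
  defines "x \<equiv> \<lambda>n. if n < length v then v ! n else 0"
  shows "x \<in> finsupp_seqs" "seq_norm (ereal t) x = pow_sum v t powr (1 / t)"
proof -
  have supp: "{n. x n \<noteq> 0} = {..<length v}"
    using assms(1)[OF nth_mem] unfolding x_def by (force split: if_splits)
  thus "x \<in> finsupp_seqs" by (simp add: finsupp_seqs_def)
  have "(\<Sum>n | x n \<noteq> 0. \<bar>x n\<bar> powr t) = (\<Sum>n<length v. v ! n powr t)"
    unfolding supp using assms(1)[OF nth_mem] by (intro sum.cong) (auto simp: x_def abs_of_pos)
  also have "\<dots> = pow_sum v t" by (simp add: pow_sum_def sum_list_sum_nth lessThan_atLeast0)
  finally show "seq_norm (ereal t) x = pow_sum v t powr (1 / t)" by (simp add: seq_norm_def)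
qed

theorem theorem1p3:
  fixes \<alpha> :: complex and T :: real
  assumes "algebraic \<alpha>" and "\<alpha> \<noteq> 0" and "T > 0"
  shows "finite {s \<in> {0<..<ereal T}. exceptional_point \<alpha> s}"
proof -
  obtain W where finW: "finite W" and pos: "\<And>w x. w \<in> W \<Longrightarrow> x \<in> set w \<Longrightarrow> x > 0"
    and up: "\<And>w. w \<in> W \<Longrightarrow> \<exists>as\<in>factorizations \<alpha>. \<forall>t>0. pow_sum (map log_mahler as) t \<le> pow_sum w t"
    and low: "\<And>as t. as \<in> factorizations \<alpha> \<Longrightarrow> t \<in> {0<..<T} \<Longrightarrow>
      \<exists>w\<in>W. pow_sum w t \<le> pow_sum (map log_mahler as) t"
    using finite_value_lists[OF assms] by metis
  \<comment> \<open>At any point of the interval, here \<open>T / 2\<close>, the trivial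
    factorization has a list below it.\<close>
  have "W \<noteq> {}" using low[OF factorization_self[OF assms(1,2)], of "T / 2"] assms(3) by auto
  obtain E where E: "finite E" "\<And>s. s \<in> {0<..<T} - E \<Longrightarrow> \<exists>v\<in>W. \<exists>e>0. \<forall>t. \<bar>t - s\<bar> < e \<longrightarrow>
        t \<in> {0<..<T} \<and> (\<forall>w\<in>W. pow_sum v t \<le> pow_sum w t)"
    by (rule finite_min_stable[OF finW \<open>W \<noteq> {}\<close>, of T]) (use pos in blast)+
  \<comment> \<open>The factorization belonging to a minimal list has its sum squeezed to the same
    value, so the infimum is attained there.\<close>
  have mm: "metric_mahler \<alpha> (ereal t) = pow_sum v t powr (1 / t)"
    if v: "v \<in> W" and t: "t \<in> {0<..<T}" and min: "\<And>w. w \<in> W \<Longrightarrow> pow_sum v t \<le> pow_sum w t" for v t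
  proof -
    have lower: "pow_sum v t \<le> pow_sum (map log_mahler as) t" if "as \<in> factorizations \<alpha>" for as
      using low[OF that t] min by fastforce
    obtain as where as: "as \<in> factorizations \<alpha>" "pow_sum (map log_mahler as) t \<le> pow_sum v t"
      using up[OF v] t by auto
    have v0: "pow_sum v t \<ge> 0" unfolding pow_sum_def by (intro sum_list_nonneg) auto
    have "(INF as\<in>factorizations \<alpha>. pow_sum (map log_mahler as) t powr (1 / t)) = pow_sum v t powr (1 / t)"
    proof (rule cInf_eq_minimum)
      show "pow_sum v t powr (1 / t) \<in> (\<lambda>as. pow_sum (map log_mahler as) t powr (1 / t)) ` factorizations \<alpha>"
        using as lower[OF as(1)] by (intro image_eqI[of _ _ as]) auto
      show "pow_sum v t powr (1 / t) \<le> y"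
        if "y \<in> (\<lambda>as. pow_sum (map log_mahler as) t powr (1 / t)) ` factorizations \<alpha>" for y
        using that lower v0 t by (auto intro!: powr_mono2)
    qed
    thus ?thesis by (simp add: metric_mahler_def pow_sum_def comp_def)
  qed
  have "standard_point \<alpha> (ereal s)" if s: "s \<in> {0<..<T} - E" for s
  proof -
    obtain v e where v: "v \<in> W" and e: "e > 0" and near: "\<And>t. \<bar>t - s\<bar> < e \<Longrightarrow>
        t \<in> {0<..<T} \<and> (\<forall>w\<in>W. pow_sum v t \<le> pow_sum w t)" using E(2)[OF s] by metis
    \<comment> \<open>One list \<open>v\<close> is minimal throughout this interval, so a single
      sequence represents the metric Mahler measure on all of it.\<close>
    define U where "U = ereal ` {s - e<..<s + e}"
    have near': "\<exists>t. u = ereal t \<and> \<bar>t - s\<bar> < e" if "u \<in> U" for u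
      using that by (auto simp: U_def abs_less_iff)
    have Upos: "U \<subseteq> {0<..}" using near' near by fastforce
    have "open U" unfolding U_def by (rule open_ereal) simp
    hence "openin (top_of_set {0<..}) U" using Upos by (metis open_subset)
    moreover have "ereal s \<in> U" using e by (simp add: U_def)
    moreover have "uniform_set \<alpha> U"
      unfolding uniform_set_def
    proof (intro conjI Upos bexI ballI)
      show "(\<lambda>n. if n < length v then v ! n else 0) \<in> finsupp_seqs"
        using seq_norm_list(1) pos[OF v] by blast
      fix u assume "u \<in> U"
      then obtain t where t: "u = ereal t" "\<bar>t - s\<bar> < e" using near' by blast
      show "metric_mahler \<alpha> u = seq_norm u (\<lambda>n. if n < length v then v ! n else 0)"
        using mm[OF v, of t] near[OF t(2)] seq_norm_list(2)[of v t] pos[OF v] t(1) by simp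
    qed
    ultimately show ?thesis using s by (auto simp: standard_point_def)
  qed
  hence "{s \<in> {0<..<ereal T}. exceptional_point \<alpha> s} \<subseteq> ereal ` E"
  proof (intro subsetI)
    fix u assume std: "\<And>s. s \<in> {0<..<T} - E \<Longrightarrow> standard_point \<alpha> (ereal s)"
      and u: "u \<in> {s \<in> {0<..<ereal T}. exceptional_point \<alpha> s}"
    then obtain s where "u = ereal s" "0 < s" "s < T" by (cases u) auto
    thus "u \<in> ereal ` E" using std[of s] u by (auto simp: exceptional_point_def)
  qed
  thus ?thesis using E(1) by (metis finite_imageI finite_subset)
qed

end
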